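(* Let $X$ be a Hausdorff space and let $B \subseteq X$ be a closed subset. If $B$ is locally collared in $X$ and $B$ is paracompact in $X$, then $B$ is collared in $X$.
   Context: Let $X$ be a topological space and $B\subseteq X$ a closed subset with the subspace topology. A family of subsets of $X$ is locally finite if each point of $X$ has an open neighborhood intersecting only finitely many members of the family. A family is a cover of $B$ if its union includes $B$. $B$ is called paracompact in $X$ if every cover $\mathcal U$ of $B$ by sets open in $X$ has a locally finite refinement that is a cover of $B$ by sets open in $X$. An embedding is a homeomorphism onto its image. A local collar of $B$ in $X$ is an embedding $c : \overline{U} \times [0,1] \to X$, where $U$ is a relatively open subset of $B$, such that $c(x,0)=x$ for all $x \in \overline{U}$, such that $c^{-1}(B) = \overline{U}\times\{0\}$, and such that $c(U\times[0,1))$ is open in $X$. A local collar of the form $c : B\times[0,1]\to X$ (that is, with $U=B$) is called a collar of $B$ in $X$. $B$ is collared in $X$ if it has a collar in $X$. $B$ is locally collared in $X$ if every $x\in B$ has a relatively open neighborhood $U\subseteq B$ such that there exists a local collar $c:\overline{U}\times[0,1]\to X$ of $B$ in $X$. *)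

theory Defs
  imports "HOL-Analysis.Analysis"
begin

text \<open>Throughout, \<open>B\<close> is meant to be a closed subset of \<open>X\<close>; the closure of a subset of \<open>B\<close> is then
  the same in \<open>B\<close> and in \<open>X\<close>.\<close>

text \<open>Members of the refinement are open in \<open>X\<close>, and local finiteness is required at every point
  of \<open>X\<close>, not only at points of \<open>B\<close>.\<close>

definition paracompact_in :: "'a topology \<Rightarrow> 'a set \<Rightarrow> bool" where
  "paracompact_in X B \<longleftrightarrow>
     (\<forall>\<U>. (\<forall>U\<in>\<U>. openin X U) \<and> B \<subseteq> \<Union>\<U> \<longrightarrow>
        (\<exists>\<V>. (\<forall>V\<in>\<V>. openin X V) \<and> B \<subseteq> \<Union>\<V> \<and>
             (\<forall>V\<in>\<V>. \<exists>U\<in>\<U>. V \<subseteq> U) \<and> locally_finite_in X \<V>))"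

text \<open>Only the values of \<open>c\<close> on \<open>(X closure_of U) \<times> {0..1}\<close> matter, so the preimage of \<open>B\<close> is taken
  within that set.\<close>

definition local_collar :: "'a topology \<Rightarrow> 'a set \<Rightarrow> 'a set \<Rightarrow> ('a \<times> real \<Rightarrow> 'a) \<Rightarrow> bool" where
  "local_collar X B U c \<longleftrightarrow>
     openin (subtopology X B) U \<and>
     embedding_map (prod_topology (subtopology X (X closure_of U)) (top_of_set {0..1})) X c \<and>
     (\<forall>x \<in> X closure_of U. c (x, 0) = x) \<and>
     {p \<in> (X closure_of U) \<times> {0..1}. c p \<in> B} = (X closure_of U) \<times> {0} \<and>
     openin X (c ` (U \<times> {0..<1}))"

definition collared_in :: "'a topology \<Rightarrow> 'a set \<Rightarrow> bool" where
  "collared_in X B \<longleftrightarrow> (\<exists>c. local_collar X B B c)"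

definition locally_collared_in :: "'a topology \<Rightarrow> 'a set \<Rightarrow> bool" where
  "locally_collared_in X B \<longleftrightarrow>
     (\<forall>x\<in>B. \<exists>U. openin (subtopology X B) U \<and> x \<in> U \<and> (\<exists>c. local_collar X B U c))"

end

theory Submission
  imports Defs
begin

text \<open>
  The idea is to extend \<open>X\<close> beyond \<open>B\<close> and to pull the extension back in. Glue an infinite outer
  cylinder \<open>B \<times> (-\<infinity>, 0]\<close> to \<open>X\<close> along \<open>B\<close>. Over the domain of a local collar, the cylinder
  and the local collar fit together to form lines that cross \<open>B\<close>. Given a bump function
  supported there, there is a homeomorphism of the extended space that slides along these lines, moves
  the cylinder up by the value of the bump function and is the identity deep inside \<open>X\<close> (lemma
  \<open>push_exists\<close>). If the bump functions of a family of local collars add up to \<open>1\<close>, then performing all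
  the slides moves the level \<open>-1\<close> of the cylinder exactly onto \<open>B\<close>, and the part of the cylinder between
  the levels \<open>-1\<close> and \<open>0\<close> lands in \<open>X\<close> as a collar (lemmas \<open>collared_in_of_charts\<close> and
  \<open>collared_in_of_outer_extension\<close>).

  Two points need care. The first is that infinitely many slides have to be composed, and a slide may
  carry a point into the supports of many others, so that local finiteness alone does not give a
  meaning to a composition in arbitrary order. The remedy is to well-order the slides and to apply larger
  ones first: a point then meets a strictly descending, hence finite, sequence of slides, and
  all points near it meet the same sequence up to slides that do not move them (lemma
  \<open>locally_finite_composition\<close>).

  The second is that \<open>X\<close> need not be regular, even at points of \<open>B\<close>, so that the image of a closed piece
  of a local collar need not be closed in \<open>X\<close>, and a slide supported on it need not be continuous.
  Paracompactness of \<open>B\<close> in \<open>X\<close> still separates disjoint closed subsets of \<open>B\<close> by open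
  subsets of \<open>X\<close>. Therefore the unwanted limit points of suitably small pieces do not lie on
  \<open>B\<close>. By local finiteness they form a closed set, and the construction takes place in its open
  complement \<open>S\<close>. A continuous positive height function
  on \<open>B\<close>, which exists by a partition of unity, keeps all the slides inside \<open>S\<close> and inside the members of
  the locally finite family.
\<close>

section \<open>Separation, partitions of unity and height functions\<close>

text \<open>A locally finite union commutes with closure. So it suffices to refine the cover of \<open>B\<close> that consists
  of the open sets with closure disjoint from \<open>D\<close> and the open sets that miss \<open>A\<close>, and to take the union of
  the members that meet \<open>A\<close>.\<close>

lemma paracompact_in_separation:
  assumes para: "paracompact_in X B" and "closedin X B" "closedin X A" "A \<subseteq> B"
    and loc: "\<And>a. a \<in> A \<Longrightarrow> \<exists>U. openin X U \<and> a \<in> U \<and> X closure_of U \<inter> D = {}"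
  obtains P where "openin X P" "A \<subseteq> P" "X closure_of P \<inter> D = {}"
proof -
  let ?\<U> = "{U. openin X U \<and> (U \<inter> A = {} \<or> X closure_of U \<inter> D = {})}"
  have "B \<subseteq> \<Union>?\<U>"
  proof
    fix b assume b: "b \<in> B"
    show "b \<in> \<Union>?\<U>"
    proof (cases "b \<in> A")
      case True
      then show ?thesis using loc by blast
    next
      case False
      moreover have "openin X (topspace X - A)" using assms(3) by blast
      moreover have "b \<in> topspace X" using b \<open>closedin X B\<close> closedin_subset by blast
      ultimately show ?thesis using b by blast
    qed
  qed
  then obtain \<V> where \<V>: "\<forall>V\<in>\<V>. openin X V" "B \<subseteq> \<Union>\<V>" "locally_finite_in X \<V>"
      and ref: "\<forall>V\<in>\<V>. \<exists>U\<in>?\<U>. V \<subseteq> U"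
    using para[unfolded paracompact_in_def, rule_format, of ?\<U>] by auto
  define \<W> where "\<W> = {V \<in> \<V>. V \<inter> A \<noteq> {}}"
  have lf: "locally_finite_in X \<W>"
    by (rule locally_finite_in_subset[OF \<V>(3)]) (auto simp: \<W>_def)
  show thesis
  proof
    show "openin X (\<Union>\<W>)" using \<V>(1) by (auto simp: \<W>_def)
    show "A \<subseteq> \<Union>\<W>" using \<open>A \<subseteq> B\<close> \<V>(2) unfolding \<W>_def by blast
    have "X closure_of V \<inter> D = {}" if V: "V \<in> \<W>" for V
    proof -
      obtain U where "U \<in> ?\<U>" "V \<subseteq> U" using ref V unfolding \<W>_def by blast
      then have "X closure_of U \<inter> D = {}" using V by (auto simp: \<W>_def)
      then show ?thesis using closure_of_mono[OF \<open>V \<subseteq> U\<close>, of X] by blast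
    qed
    then show "X closure_of \<Union>\<W> \<inter> D = {}"
      by (auto simp: closure_of_locally_finite_Union[OF lf])
  qed
qed

lemma disjoint_open_imp_closure_disjoint:
  assumes "openin X U" "U \<inter> P = {}" shows "X closure_of P \<inter> U = {}"
  using openin_Int_closure_of_eq_empty[OF assms(1), of P] assms(2) by auto

lemma paracompact_in_separates_point:
  assumes "Hausdorff_space X" "paracompact_in X B" "closedin X B" "closedin X A" "A \<subseteq> B"
    and "x \<in> topspace X" "x \<notin> A"
  obtains P where "openin X P" "A \<subseteq> P" "x \<notin> X closure_of P"
proof -
  have "\<exists>U. openin X U \<and> a \<in> U \<and> X closure_of U \<inter> {x} = {}" if a: "a \<in> A" for a
  proof -
    have "a \<in> topspace X" "a \<noteq> x" using a assms closedin_subset by blast+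
    then obtain U W where "openin X U" "openin X W" "a \<in> U" "x \<in> W" "disjnt U W"
      using assms(1,6) unfolding Hausdorff_space_def by metis
    moreover have "X closure_of U \<inter> W = {}"
      by (rule disjoint_open_imp_closure_disjoint) (use calculation in \<open>auto simp: disjnt_def\<close>)
    ultimately show ?thesis by blast
  qed
  from paracompact_in_separation[OF assms(2-5) this] that show thesis by auto
qed

text \<open>Normality of \<open>B\<close>, with separating sets that are open in the whole space. The set \<open>A'\<close> has to lie in
  \<open>B\<close>: a point of \<open>B\<close> and a closed set that leaves \<open>B\<close> may fail to have disjoint neighbourhoods.\<close>

lemma paracompact_in_separates_closed:
  assumes "Hausdorff_space X" "paracompact_in X B" "closedin X B"
    and A: "closedin X A" "A \<subseteq> B" and A': "closedin X A'" "A' \<subseteq> B" "A \<inter> A' = {}"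
  obtains P where "openin X P" "A \<subseteq> P" "X closure_of P \<inter> A' = {}"
proof -
  have "\<exists>U. openin X U \<and> a \<in> U \<and> X closure_of U \<inter> A' = {}" if a: "a \<in> A" for a
  proof -
    have "a \<in> topspace X" "a \<notin> A'" using a assms closedin_subset by blast+
    then obtain P where P: "openin X P" "A' \<subseteq> P" "a \<notin> X closure_of P"
      using paracompact_in_separates_point[OF assms(1-3) A'(1,2)] by metis
    let ?U = "topspace X - X closure_of P"
    have "?U \<inter> P = {}" using closure_of_subset[OF openin_subset[OF P(1)]] by auto
    then have "X closure_of ?U \<inter> P = {}"
      by (intro disjoint_open_imp_closure_disjoint[OF P(1)]) auto
    moreover have "openin X ?U" by (simp add: openin_diff)
    ultimately show ?thesis using P \<open>a \<in> topspace X\<close> by blast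
  qed
  from paracompact_in_separation[OF assms(2,3) A this] that show thesis by auto
qed

lemma paracompact_in_imp_normal_space:
  assumes "Hausdorff_space X" "paracompact_in X B" "closedin X B"
  shows "normal_space (subtopology X B)"
  unfolding normal_space_def
proof (intro allI impI, elim conjE)
  fix S T assume ST: "closedin (subtopology X B) S" "closedin (subtopology X B) T" "disjnt S T"
  then have *: "closedin X S" "S \<subseteq> B" "closedin X T" "T \<subseteq> B" "S \<inter> T = {}"
    using closedin_closed_subtopology[OF assms(3)] by (auto simp: disjnt_def)
  obtain P where P: "openin X P" "S \<subseteq> P" "X closure_of P \<inter> T = {}"
    using paracompact_in_separates_closed[OF assms *] .
  have "openin X (topspace X - X closure_of P)" by (simp add: openin_diff)
  moreover have "T \<subseteq> topspace X" using * closedin_subset by blast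
  moreover have "P \<subseteq> X closure_of P" by (simp add: P(1) closure_of_subset openin_subset)
  ultimately show "\<exists>U V. openin (subtopology X B) U \<and> openin (subtopology X B) V \<and> S \<subseteq> U \<and> T \<subseteq> V \<and> disjnt U V"
    using P * by (intro exI[of _ "P \<inter> B"] exI[of _ "(topspace X - X closure_of P) \<inter> B"])
      (auto simp: openin_subtopology_Int disjnt_def)
qed

lemma continuous_map_locally_finite_sum:
  fixes f :: "'a set \<Rightarrow> 'a \<Rightarrow> real"
  assumes "locally_finite_in X \<V>" "B \<subseteq> topspace X"
    and cont: "\<And>V. V \<in> \<V> \<Longrightarrow> continuous_map (subtopology X B) euclideanreal (f V)"
    and zero: "\<And>V x. V \<in> \<V> \<Longrightarrow> x \<in> B - V \<Longrightarrow> f V x = 0"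
  shows "continuous_map (subtopology X B) euclideanreal (\<lambda>x. \<Sum>V\<in>{V\<in>\<V>. x \<in> V}. f V x)"
proof -
  have "\<forall>x\<in>topspace X. \<exists>N. openin X N \<and> x \<in> N \<and> finite {V\<in>\<V>. V \<inter> N \<noteq> {}}"
    using assms(1) unfolding locally_finite_in_def by simp
  from bchoice[OF this] obtain N
    where N: "\<And>x. x \<in> topspace X \<Longrightarrow> openin X (N x) \<and> x \<in> N x \<and> finite {V\<in>\<V>. V \<inter> N x \<noteq> {}}"
    by auto
  show ?thesis
  proof (rule pasting_lemma[where I=B and T="\<lambda>x. B \<inter> N x"
        and f="\<lambda>b x. \<Sum>V\<in>{V\<in>\<V>. V \<inter> N b \<noteq> {}}. f V x"])
    have sum_eq: "(\<Sum>V\<in>{V\<in>\<V>. x \<in> V}. f V x) = (\<Sum>V\<in>{V\<in>\<V>. V \<inter> N b \<noteq> {}}. f V x)"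
      if "b \<in> B" "x \<in> B \<inter> N b" for b x
      by (rule sum.mono_neutral_left) (use that N[of b] assms(2) zero in auto)
    show "openin (subtopology X B) (B \<inter> N x)" if "x \<in> B" for x
      using that N assms(2) by (meson in_mono openin_subtopology_Int2)
    show "continuous_map (subtopology (subtopology X B) (B \<inter> N x)) euclideanreal
          (\<lambda>y. \<Sum>V\<in>{V\<in>\<V>. V \<inter> N x \<noteq> {}}. f V y)" if "x \<in> B" for x
    proof (intro continuous_map_sum)
      show "finite {V\<in>\<V>. V \<inter> N x \<noteq> {}}" using that N assms(2) by blast
    qed (auto intro: continuous_map_from_subtopology cont)
    show "(\<Sum>V\<in>{V\<in>\<V>. V \<inter> N i \<noteq> {}}. f V x) = (\<Sum>V\<in>{V\<in>\<V>. V \<inter> N j \<noteq> {}}. f V x)"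
      if "i \<in> B" "j \<in> B" "x \<in> topspace (subtopology X B) \<inter> (B \<inter> N i) \<inter> (B \<inter> N j)" for i j x
      using that sum_eq[of i x] sum_eq[of j x] by auto
    show "\<exists>j. j \<in> B \<and> x \<in> B \<inter> N j \<and>
          (\<Sum>V\<in>{V\<in>\<V>. x \<in> V}. f V x) = (\<Sum>V\<in>{V\<in>\<V>. V \<inter> N j \<noteq> {}}. f V x)"
      if "x \<in> topspace (subtopology X B)" for x
      using that N[of x] sum_eq[of x x] by auto
  qed
qed

text \<open>A partition of unity on \<open>B\<close> subordinate to \<open>\<V>\<close>; the closed sets \<open>A V\<close> witness that the supports stay
  inside the members.\<close>

definition subordinate_partition ::
  "'a topology \<Rightarrow> 'a set \<Rightarrow> 'a set set \<Rightarrow> ('a set \<Rightarrow> 'a \<Rightarrow> real) \<Rightarrow> ('a set \<Rightarrow> 'a set) \<Rightarrow> bool" where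
  "subordinate_partition X B \<V> \<phi> A \<longleftrightarrow>
     (\<forall>V\<in>\<V>. continuous_map (subtopology X B) euclideanreal (\<phi> V) \<and>
        closedin X (A V) \<and> A V \<subseteq> V \<inter> B \<and>
        (\<forall>x\<in>B. 0 \<le> \<phi> V x) \<and> (\<forall>x\<in>B - A V. \<phi> V x = 0)) \<and>
     (\<forall>x\<in>B. (\<Sum>V\<in>{V\<in>\<V>. x \<in> V}. \<phi> V x) = 1)"

text \<open>Refining by sets whose closures lie in members of \<open>\<V>\<close>, and collecting the closures that belong to the
  same member, shrinks \<open>\<V>\<close> to a cover by closed sets \<open>C V \<subseteq> V\<close>. Urysohn functions for these
  shrinkings are then normalised.\<close>

lemma paracompact_in_partition_of_unity:
  assumes X: "Hausdorff_space X" "paracompact_in X B" "closedin X B"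
    and \<V>: "\<And>V. V \<in> \<V> \<Longrightarrow> openin X V" "B \<subseteq> \<Union>\<V>" "locally_finite_in X \<V>"
  shows "\<exists>\<phi> A. subordinate_partition X B \<V> \<phi> A"
proof -
  have BX: "B \<subseteq> topspace X" using X(3) closedin_subset by blast
  let ?\<O> = "{Q. openin X Q \<and> (\<exists>V\<in>\<V>. X closure_of Q \<inter> B \<subseteq> V)}"
  have "B \<subseteq> \<Union>?\<O>"
  proof
    fix b assume b: "b \<in> B"
    then obtain V where V: "V \<in> \<V>" "b \<in> V" using \<V> by blast
    have "closedin X {b}" using X(1) b BX
      by (simp add: closedin_Hausdorff_singleton in_mono)
    moreover have "closedin X (B - V)" using X(3) \<V>(1) V by blast
    ultimately obtain P where "openin X P" "{b} \<subseteq> P" "X closure_of P \<inter> (B - V) = {}"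
      using paracompact_in_separates_closed[OF X, of "{b}" "B - V"] b V by auto
    then show "b \<in> \<Union>?\<O>" using V by blast
  qed
  then obtain \<U> where \<U>: "\<forall>U\<in>\<U>. openin X U" "B \<subseteq> \<Union>\<U>" "locally_finite_in X \<U>"
      and "\<forall>U\<in>\<U>. \<exists>Q\<in>?\<O>. U \<subseteq> Q"
    using X(2)[unfolded paracompact_in_def, rule_format, of ?\<O>] by auto
  moreover have "\<exists>V\<in>\<V>. X closure_of U \<inter> B \<subseteq> V" if "U \<subseteq> Q" "Q \<in> ?\<O>" for U Q
    using closure_of_mono[OF that(1), of X] that(2) by blast
  ultimately have "\<forall>U\<in>\<U>. \<exists>V\<in>\<V>. X closure_of U \<inter> B \<subseteq> V"
    by meson
  then obtain v where v: "\<And>U. U \<in> \<U> \<Longrightarrow> v U \<in> \<V>" "\<And>U. U \<in> \<U> \<Longrightarrow> X closure_of U \<inter> B \<subseteq> v U"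
    by metis
  define C where "C V = \<Union>((closure_of) X ` {U\<in>\<U>. v U = V}) \<inter> B" for V
  have C_closed: "closedin X (C V)" for V
  proof -
    have lf: "locally_finite_in X {U\<in>\<U>. v U = V}"
      by (rule locally_finite_in_subset[OF \<U>(3)]) auto
    show ?thesis
      unfolding C_def closure_of_locally_finite_Union[OF lf, symmetric]
      by (intro closedin_Int X(3)) simp
  qed
  have C_sub: "C V \<subseteq> V" for V using v by (auto simp: C_def)
  have C_cover: "\<exists>V\<in>\<V>. x \<in> V \<and> x \<in> C V" if x: "x \<in> B" for x
  proof -
    obtain U where U: "U \<in> \<U>" "x \<in> U" using \<U> x by blast
    have "U \<subseteq> X closure_of U" using \<U>(1) U(1) by (simp add: closure_of_subset openin_subset)
    then have "x \<in> X closure_of U" using U(2) by blast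
    then have "x \<in> C (v U)" using U x by (auto simp: C_def)
    then show ?thesis using v(1) U(1) C_sub by blast
  qed
  have "\<exists>f. continuous_map (subtopology X B) (top_of_set {0..1::real}) f \<and>
            f ` C V \<subseteq> {1} \<and> f ` (B - V) \<subseteq> {0}" if V: "V \<in> \<V>" for V
  proof -
    have "closedin (subtopology X B) (C V)" "closedin (subtopology X B) (B - V)"
      using C_closed X(3) \<V>(1)[OF V]
      by (auto simp: closedin_closed_subtopology C_def closedin_diff)
    moreover have "disjnt (B - V) (C V)" using C_sub by (auto simp: disjnt_def)
    ultimately show ?thesis
      using Urysohn_lemma[OF paracompact_in_imp_normal_space[OF X], of "B - V" "C V" 0 1]
      by (metis zero_le_one)
  qed
  then obtain f where f: "\<And>V. V \<in> \<V> \<Longrightarrow> continuous_map (subtopology X B) (top_of_set {0..1::real}) (f V)"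
    and fC: "\<And>V. V \<in> \<V> \<Longrightarrow> f V ` C V \<subseteq> {1}" and fV: "\<And>V. V \<in> \<V> \<Longrightarrow> f V ` (B - V) \<subseteq> {0}"
    by metis
  have f_cont: "continuous_map (subtopology X B) euclideanreal (f V)" if "V \<in> \<V>" for V
    using f[OF that] by (simp add: continuous_map_in_subtopology)
  \<comment> \<open>Cutting the Urysohn function off at \<open>1/2\<close> pushes its support into a closed
    subset of \<open>V\<close>.\<close>
  define A where "A V = {x \<in> B. f V x \<ge> 1/2}" for V
  define g where "g V x = max 0 (f V x - 1/2)" for V x
  define \<sigma> where "\<sigma> x = (\<Sum>V\<in>{V\<in>\<V>. x \<in> V}. g V x)" for x
  have AV: "A V \<subseteq> V \<inter> B" if "V \<in> \<V>" for V
    using fV[OF that] by (force simp: A_def)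
  have gz: "g V x = 0" if "V \<in> \<V>" "x \<in> B - A V" for V x
    using that by (auto simp: g_def A_def)
  have g_cont: "continuous_map (subtopology X B) euclideanreal (g V)" if "V \<in> \<V>" for V
    unfolding g_def using f_cont[OF that] by (intro continuous_intros) auto
  have \<sigma>_cont: "continuous_map (subtopology X B) euclideanreal \<sigma>"
    unfolding \<sigma>_def
    by (rule continuous_map_locally_finite_sum[OF \<V>(3) BX g_cont]) (use gz AV in blast)+
  have \<sigma>_pos: "\<sigma> x > 0" if x: "x \<in> B" for x
  proof -
    obtain V where V: "V \<in> \<V>" "x \<in> V" "x \<in> C V" using C_cover x by blast
    have "finite {V\<in>\<V>. x \<in> V}"
    proof -
      obtain N where "x \<in> N" "finite {V\<in>\<V>. V \<inter> N \<noteq> {}}"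
        using \<V>(3) x BX unfolding locally_finite_in_def by (meson in_mono)
      then show ?thesis by (elim rev_finite_subset) auto
    qed
    moreover have "g V x > 0" using fC[OF V(1)] V(3) by (auto simp: g_def)
    ultimately show ?thesis unfolding \<sigma>_def using V
      by (intro sum_pos2[where i=V]) (auto simp: g_def)
  qed
  have "subordinate_partition X B \<V> (\<lambda>V x. g V x / \<sigma> x) A"
    unfolding subordinate_partition_def
  proof (intro conjI ballI)
    show "continuous_map (subtopology X B) euclideanreal (\<lambda>x. g V x / \<sigma> x)" if "V \<in> \<V>" for V
      using g_cont[OF that] \<sigma>_cont \<sigma>_pos by (intro continuous_map_real_divide) force+
    show "0 \<le> g V x / \<sigma> x" if "V \<in> \<V>" "x \<in> B" for V x
      using \<sigma>_pos[OF that(2)] by (simp add: g_def)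
    show "closedin X (A V)" if "V \<in> \<V>" for V
    proof -
      have "closedin (subtopology X B) {x \<in> topspace (subtopology X B). f V x \<in> {1/2..}}"
        using f_cont[OF that] by (intro closedin_continuous_map_preimage) auto
      moreover have "{x \<in> topspace (subtopology X B). f V x \<in> {1/2..}} = A V"
        using BX by (auto simp: A_def)
      ultimately show ?thesis using X(3) closedin_trans_full by (metis)
    qed
    show "A V \<subseteq> V \<inter> B" if "V \<in> \<V>" for V using AV[OF that] .
    show "g V x / \<sigma> x = 0" if "V \<in> \<V>" "x \<in> B - A V" for V x using gz[OF that] by simp
    show "(\<Sum>V\<in>{V\<in>\<V>. x \<in> V}. g V x / \<sigma> x) = 1" if "x \<in> B" for x
      using \<sigma>_pos[OF that] by (simp add: sum_divide_distrib[symmetric] \<sigma>_def[symmetric])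
  qed
  then show ?thesis by blast
qed

text \<open>The admissible values at each point form an interval that starts at \<open>0\<close>. A convex combination of local
  bounds is at most the largest of them, hence still admissible.\<close>

lemma paracompact_in_continuous_selection:
  fixes good :: "'a \<Rightarrow> real \<Rightarrow> bool"
  assumes X: "Hausdorff_space X" "paracompact_in X B" "closedin X B"
    and down: "\<And>x s t. x \<in> B \<Longrightarrow> good x t \<Longrightarrow> 0 < s \<Longrightarrow> s \<le> t \<Longrightarrow> good x s"
    and loc: "\<And>b. b \<in> B \<Longrightarrow> \<exists>N \<epsilon>. openin X N \<and> b \<in> N \<and> \<epsilon> > 0 \<and> (\<forall>x\<in>N \<inter> B. good x \<epsilon>)"
  shows "\<exists>\<kappa>. continuous_map (subtopology X B) euclideanreal \<kappa> \<and> (\<forall>x\<in>B. 0 < \<kappa> x \<and> good x (\<kappa> x))"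
proof -
  have BX: "B \<subseteq> topspace X" using X(3) closedin_subset by blast
  let ?\<O> = "{N. openin X N \<and> (\<exists>\<epsilon>>0. \<forall>x\<in>N \<inter> B. good x \<epsilon>)}"
  have "B \<subseteq> \<Union>?\<O>" using loc by blast
  then obtain \<V> where \<V>: "\<forall>V\<in>\<V>. openin X V" "B \<subseteq> \<Union>\<V>" "locally_finite_in X \<V>"
      and "\<forall>V\<in>\<V>. \<exists>N\<in>?\<O>. V \<subseteq> N"
    using X(2)[unfolded paracompact_in_def, rule_format, of ?\<O>] by auto
  moreover have "\<exists>\<epsilon>>0. \<forall>x\<in>V \<inter> B. good x \<epsilon>" if "V \<subseteq> N" "N \<in> ?\<O>" for V N
    using that by blast
  ultimately have "\<forall>V\<in>\<V>. \<exists>\<epsilon>>0. \<forall>x\<in>V \<inter> B. good x \<epsilon>" by meson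
  then obtain \<epsilon> where \<epsilon>: "\<And>V. V \<in> \<V> \<Longrightarrow> \<epsilon> V > 0" "\<And>V x. V \<in> \<V> \<Longrightarrow> x \<in> V \<inter> B \<Longrightarrow> good x (\<epsilon> V)"
    by metis
  obtain \<phi> A where "subordinate_partition X B \<V> \<phi> A"
    using paracompact_in_partition_of_unity[OF X \<V>(1)[rule_format] \<V>(2,3)] by blast
  then have \<phi>: "\<And>V. V \<in> \<V> \<Longrightarrow> continuous_map (subtopology X B) euclideanreal (\<phi> V)"
    "\<And>V x. V \<in> \<V> \<Longrightarrow> x \<in> B \<Longrightarrow> 0 \<le> \<phi> V x"
    "\<And>V x. V \<in> \<V> \<Longrightarrow> x \<in> B - V \<Longrightarrow> \<phi> V x = 0"
    "\<And>x. x \<in> B \<Longrightarrow> (\<Sum>V\<in>{V\<in>\<V>. x \<in> V}. \<phi> V x) = 1"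
    unfolding subordinate_partition_def by blast+
  define \<kappa> where "\<kappa> x = (\<Sum>V\<in>{V\<in>\<V>. x \<in> V}. \<phi> V x * \<epsilon> V)" for x
  have fin: "finite {V\<in>\<V>. x \<in> V}" and ne: "{V\<in>\<V>. x \<in> V} \<noteq> {}" if x: "x \<in> B" for x
  proof -
    obtain N where "x \<in> N" "finite {V\<in>\<V>. V \<inter> N \<noteq> {}}"
      using \<V>(3) x BX unfolding locally_finite_in_def by (meson in_mono)
    then show "finite {V\<in>\<V>. x \<in> V}" by (elim rev_finite_subset) auto
    show "{V\<in>\<V>. x \<in> V} \<noteq> {}" using \<V> x by blast
  qed
  have pos: "0 < \<kappa> x" if x: "x \<in> B" for x
  proof -
    obtain V where V: "V \<in> \<V>" "x \<in> V" "\<phi> V x \<noteq> 0"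
      using \<phi>(4)[OF x] by (metis (mono_tags, lifting) mem_Collect_eq sum.neutral zero_neq_one)
    then show ?thesis unfolding \<kappa>_def
      using fin[OF x] \<phi>(2) x \<epsilon>(1)
      by (intro sum_pos2[where i=V]) (auto simp: less_le intro!: mult_nonneg_nonneg)
  qed
  show ?thesis
  proof (intro exI[of _ \<kappa>] conjI ballI)
    show "continuous_map (subtopology X B) euclideanreal \<kappa>"
      unfolding \<kappa>_def
      using \<phi> by (intro continuous_map_locally_finite_sum[OF \<V>(3) BX] continuous_intros) auto
    show "0 < \<kappa> x" if "x \<in> B" for x using pos[OF that] .
    show "good x (\<kappa> x)" if x: "x \<in> B" for x
    proof -
      let ?m = "Max (\<epsilon> ` {V\<in>\<V>. x \<in> V})"
      have "\<kappa> x \<le> (\<Sum>V\<in>{V\<in>\<V>. x \<in> V}. \<phi> V x * ?m)"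
        unfolding \<kappa>_def using fin[OF x] \<phi>(2) x by (intro sum_mono mult_left_mono) auto
      also have "\<dots> = ?m" using \<phi>(4)[OF x] by (simp add: sum_distrib_right[symmetric])
      finally have "\<kappa> x \<le> ?m" .
      moreover have "?m \<in> \<epsilon> ` {V\<in>\<V>. x \<in> V}" using fin[OF x] ne[OF x] by (intro Max_in) auto
      then have "good x ?m" using \<epsilon>(2) x by auto
      ultimately show ?thesis using down[OF x _ pos[OF x]] by blast
    qed
  qed
qed

section \<open>Sliding along the lines of one chart\<close>

text \<open>The slide on a single line: the piecewise linear homeomorphism of the reals that translates the
  half-line below \<open>-a\<close> by \<open>a\<close>, compresses the interval from \<open>-a\<close> to \<open>h\<close> to the one from \<open>0\<close> to
  \<open>h\<close>, and fixes everything above \<open>h\<close>. The max-min form makes joint continuity in all three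
  variables evident.\<close>

definition stretch :: "real \<Rightarrow> real \<Rightarrow> real \<Rightarrow> real" where
  "stretch a h t = max t (min (t + a) (h * (t + a) / (h + a)))"

definition unstretch :: "real \<Rightarrow> real \<Rightarrow> real \<Rightarrow> real" where
  "unstretch a h t = min t (max (t - a) (t * (h + a) / h - a))"

lemma stretch_eq:
  assumes "0 \<le> a" "0 < h"
  shows "stretch a h t = (if t \<le> - a then t + a else if t \<le> h then h * (t + a) / (h + a) else t)"
proof -
  have d: "0 < h + a" using assms by simp
  have up: "h * (t + a) / (h + a) \<le> t + a \<longleftrightarrow> 0 \<le> a * (t + a)"
    unfolding pos_divide_le_eq[OF d] by (simp add: algebra_simps)
  have lo: "t \<le> h * (t + a) / (h + a) \<longleftrightarrow> a * t \<le> a * h"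
    unfolding pos_le_divide_eq[OF d] by (simp add: algebra_simps)
  have low: "t + a \<le> h * (t + a) / (h + a) \<longleftrightarrow> a * (t + a) \<le> 0"
    unfolding pos_le_divide_eq[OF d] by (simp add: algebra_simps)
  consider "t \<le> - a" | "- a < t" "t \<le> h" | "- a < t" "h < t" by linarith
  then show ?thesis
  proof cases
    case 1
    then have "t + a \<le> h * (t + a) / (h + a)" using assms low by (simp add: mult_nonneg_nonpos)
    then show ?thesis using 1 assms by (simp add: stretch_def)
  next
    case 2
    then have "h * (t + a) / (h + a) \<le> t + a" "t \<le> h * (t + a) / (h + a)"
      using assms up lo by (simp_all add: mult_left_mono)
    then show ?thesis using 2 by (simp add: stretch_def)
  next
    case 3
    then have "h * (t + a) / (h + a) \<le> t + a" using assms up by simp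
    moreover have "h * (t + a) / (h + a) \<le> t"
      unfolding pos_divide_le_eq[OF d] using 3 assms mult_left_mono[of h t a] by (simp add: algebra_simps)
    ultimately show ?thesis using 3 by (simp add: stretch_def)
  qed
qed

lemma unstretch_eq:
  assumes "0 \<le> a" "0 < h"
  shows "unstretch a h t = (if t \<le> 0 then t - a else if t \<le> h then t * (h + a) / h - a else t)"
proof -
  have 1: "t * (h + a) / h - a \<le> t - a \<longleftrightarrow> a * t \<le> 0"
    using assms by (simp add: pos_divide_le_eq algebra_simps)
  have 2: "t \<le> t * (h + a) / h - a \<longleftrightarrow> a * h \<le> a * t"
    using assms by (simp add: le_diff_eq pos_le_divide_eq algebra_simps)
  show ?thesis
  proof (cases "a = 0")
    case True
    then show ?thesis using assms by (simp add: unstretch_def)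
  next
    case False
    then show ?thesis using assms 1 2 unfolding unstretch_def
      by (auto simp: mult_le_0_iff mult_le_cancel_left min_def max_def)
  qed
qed

lemma stretch_unstretch:
  assumes "0 \<le> a" "0 < h"
  shows "stretch a h (unstretch a h t) = t" "unstretch a h (stretch a h t) = t"
proof -
  have d: "0 < h + a" using assms by simp
  consider "t \<le> 0" | "0 < t" "t \<le> h" | "h < t" by linarith
  then show "stretch a h (unstretch a h t) = t"
  proof cases
    case 2
    define w where "w = t * (h + a) / h - a"
    have "- a < w" using 2 assms d by (simp add: w_def)
    moreover have "w \<le> h"
      using 2 assms mult_right_mono[OF 2(2), of "h + a"] by (simp add: w_def diff_le_eq pos_divide_le_eq)
    moreover have "h * (w + a) / (h + a) = t" using assms d by (simp add: w_def)
    moreover have "unstretch a h t = w" using 2 assms by (simp add: unstretch_eq w_def)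
    ultimately show ?thesis using assms by (simp add: stretch_eq)
  qed (use assms in \<open>auto simp: stretch_eq unstretch_eq\<close>)
  consider "t \<le> - a" | "- a < t" "t \<le> h" | "h < t" by linarith
  then show "unstretch a h (stretch a h t) = t"
  proof cases
    case 2
    define w where "w = h * (t + a) / (h + a)"
    have "0 < w" using 2 assms d by (simp add: w_def)
    moreover have "w \<le> h" using 2 assms by (simp add: w_def pos_divide_le_eq[OF d])
    moreover have "w * (h + a) / h - a = t" using assms d by (simp add: w_def)
    moreover have "stretch a h t = w" using 2 assms by (simp add: stretch_eq w_def)
    ultimately show ?thesis using assms by (simp add: unstretch_eq)
  qed (use assms in \<open>auto simp: stretch_eq unstretch_eq\<close>)
qed

lemma stretch_le: "0 \<le> a \<Longrightarrow> 0 < h \<Longrightarrow> t \<le> h \<Longrightarrow> stretch a h t \<le> h"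
  by (auto simp: stretch_eq pos_divide_le_eq)

lemma stretch_nonneg: "0 \<le> a \<Longrightarrow> 0 < h \<Longrightarrow> - a \<le> t \<Longrightarrow> 0 \<le> stretch a h t"
  by (auto simp: stretch_eq)

text \<open>The space \<open>S\<close> with the cylinder \<open>B \<times> (-\<infinity>, 0]\<close> attached along \<open>B\<close>. It is realised inside
  \<open>X \<times> \<real>\<close>, where \<open>S\<close> is the level \<open>0\<close>, so that no quotient topology is involved.\<close>

definition outer_extension :: "'a topology \<Rightarrow> 'a set \<Rightarrow> 'a set \<Rightarrow> ('a \<times> real) topology" where
  "outer_extension X S B = subtopology (prod_topology X euclideanreal) (S \<times> {0} \<union> B \<times> {..0})"

text \<open>Over \<open>G\<close>, the extended space has coordinates \<open>(z, t)\<close> with \<open>t\<close> ranging over all reals below \<open>1\<close>: the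
  point \<open>(c (z, t), 0)\<close> for \<open>t \<ge> 0\<close>, and \<open>(z, t)\<close> for \<open>t \<le> 0\<close>. Both cases are captured by
  \<open>(c (z, max t 0), min t 0)\<close>, with inverse \<open>(x, s) \<mapsto> (fst (d x), snd (d x) + s)\<close>; a slide applies
  \<open>\<theta> z\<close> to the second coordinate.\<close>

definition slide :: "('a \<times> real \<Rightarrow> 'a) \<Rightarrow> ('a \<Rightarrow> 'a \<times> real) \<Rightarrow> 'a set \<Rightarrow> ('a \<Rightarrow> real \<Rightarrow> real) \<Rightarrow> 'a \<times> real \<Rightarrow> 'a \<times> real" where
  "slide c d G \<theta> y = (if fst y \<in> G
     then let z = fst (d (fst y)); t = \<theta> z (snd (d (fst y)) + snd y) in (c (z, max t 0), min t 0)
     else y)"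

text \<open>A half-open local collar \<open>c\<close> over \<open>U\<close> with inverse \<open>d\<close> and image \<open>G\<close>, together with a part \<open>A\<close> of its
  base and a height function \<open>h\<close> such that the region \<open>K\<close> below height \<open>h\<close> over \<open>A\<close> is closed in \<open>S\<close>.
  The image \<open>G\<close> may leave \<open>S\<close>; only \<open>K\<close> has to stay inside.\<close>

locale collar_chart =
  fixes X :: "'a topology" and S B U G A K :: "'a set" and c d and h :: "'a \<Rightarrow> real"
  assumes S: "openin X S" and B: "B \<subseteq> S"
    and U: "U \<subseteq> B" and G: "openin X G"
    and homeo: "homeomorphic_maps (prod_topology (subtopology X U) (top_of_set {0..<1})) (subtopology X G) c d"
    and c0: "\<And>x. x \<in> U \<Longrightarrow> c (x, 0) = x"
    and cB: "\<And>x t. x \<in> U \<Longrightarrow> t \<in> {0..<1} \<Longrightarrow> c (x, t) \<in> B \<Longrightarrow> t = 0"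
    and A: "A \<subseteq> U"
    and h: "\<And>x. x \<in> U \<Longrightarrow> 0 < h x" "\<And>x. x \<in> U \<Longrightarrow> h x < 1"
    and K: "K = c ` {(x, t). x \<in> A \<and> 0 \<le> t \<and> t \<le> h x}"
    and K_closed: "closedin (subtopology X S) K"
begin

abbreviation "Y \<equiv> outer_extension X S B"

lemma top_Y: "topspace Y = S \<times> {0} \<union> B \<times> {..0}"
  using openin_subset[OF S] B by (auto simp: outer_extension_def)

lemma dG: "x \<in> G \<Longrightarrow> fst (d x) \<in> U \<and> 0 \<le> snd (d x) \<and> snd (d x) < 1 \<and> c (d x) = x"
proof -
  assume x: "x \<in> G"
  then have "x \<in> topspace (subtopology X G)" using openin_subset[OF G] by auto
  then have "d x \<in> topspace (prod_topology (subtopology X U) (top_of_set {0..<1}))" "c (d x) = x"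
    using homeo unfolding homeomorphic_maps_def continuous_map_def by (auto simp: Pi_iff)
  then show ?thesis by (auto simp: mem_Times_iff)
qed

lemma cG: "x \<in> U \<Longrightarrow> 0 \<le> t \<Longrightarrow> t < 1 \<Longrightarrow> c (x, t) \<in> G \<and> d (c (x, t)) = (x, t)"
proof -
  assume x: "x \<in> U" "0 \<le> t" "t < 1"
  then have "(x, t) \<in> topspace (prod_topology (subtopology X U) (top_of_set {0..<1}))"
    using openin_subset[OF S] B U by auto
  then show ?thesis
    using homeo unfolding homeomorphic_maps_def continuous_map_def by (auto simp: Pi_iff)
qed

lemma UG: "x \<in> U \<Longrightarrow> x \<in> G \<and> d x = (x, 0)"
  using cG[of x 0] c0 by auto

lemma BG: "x \<in> B \<Longrightarrow> x \<in> G \<Longrightarrow> x \<in> U \<and> d x = (x, 0)"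
proof -
  assume x: "x \<in> B" "x \<in> G"
  then have "snd (d x) = 0" using dG[OF x(2)] cB[of "fst (d x)" "snd (d x)"] by auto
  then have "x = fst (d x)" using dG[OF x(2)] c0[of "fst (d x)"] by (metis prod.collapse)
  then show ?thesis using dG[OF x(2)] UG by metis
qed

lemma AK: "x \<in> A \<Longrightarrow> x \<in> K"
  unfolding K using A h c0 by (force intro!: image_eqI[of _ _ "(x, 0)"])

lemma KB: "x \<in> K \<Longrightarrow> x \<in> B \<Longrightarrow> x \<in> A"
  unfolding K using A h cB c0 by (force simp: subset_iff)

lemma slide_fixes:
  assumes y: "y \<in> topspace Y"
    and \<theta>: "fst y \<in> G \<Longrightarrow> \<theta> (fst (d (fst y))) (snd (d (fst y)) + snd y) = snd (d (fst y)) + snd y"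
  shows "slide c d G \<theta> y = y"
proof (cases "fst y \<in> G \<and> snd y < 0")
  case True
  then have "fst y \<in> B" using y by (auto simp: top_Y)
  with True BG have "d (fst y) = (fst y, 0)" "fst y \<in> U" by blast+
  then show ?thesis using True \<theta> c0 by (simp add: slide_def Let_def prod_eq_iff)
next
  case False
  then have "snd y = 0 \<or> fst y \<notin> G" using y by (auto simp: top_Y)
  moreover obtain z t where "d (fst y) = (z, t)" by force
  ultimately show ?thesis using \<theta> dG[of "fst y"]
    by (intro prod_eqI) (auto simp: slide_def Let_def max_def min_def)
qed

lemma slide_id_outside:
  assumes y: "y \<in> topspace Y" "fst y \<notin> K"
    and fix_t: "\<And>z t. z \<in> U \<Longrightarrow> z \<notin> A \<or> h z \<le> t \<Longrightarrow> \<theta> z t = t"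
  shows "slide c d G \<theta> y = y"
proof (rule slide_fixes[OF y(1)])
  assume G: "fst y \<in> G"
  show "\<theta> (fst (d (fst y))) (snd (d (fst y)) + snd y) = snd (d (fst y)) + snd y"
  proof (rule fix_t)
    show "fst (d (fst y)) \<in> U" using dG[OF G] by blast
    show "fst (d (fst y)) \<notin> A \<or> h (fst (d (fst y))) \<le> snd (d (fst y)) + snd y"
    proof (rule ccontr)
      assume neg: "\<not> ?thesis"
      then have zA: "fst (d (fst y)) \<in> A" by blast
      have "snd (d (fst y)) \<le> h (fst (d (fst y)))"
      proof (cases "snd y < 0")
        case True
        then have "fst y \<in> B" using y by (auto simp: top_Y)
        then show ?thesis using BG[OF _ G] h by (auto simp: less_imp_le)
      next
        case False
        then have "snd y = 0" using y by (auto simp: top_Y)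
        then show ?thesis using neg by auto
      qed
      then have "c (d (fst y)) \<in> K"
        unfolding K using zA dG[OF G] by (intro imageI) (auto simp: case_prod_beta)
      then show False using dG[OF G] y(2) by simp
    qed
  qed
qed

text \<open>Although the chart may leave \<open>S\<close>, a slide moves points only within \<open>K\<close> and the cylinder.\<close>

lemma slide_in:
  assumes y: "y \<in> topspace Y"
    and fix_t: "\<And>z t. z \<in> U \<Longrightarrow> z \<notin> A \<or> h z \<le> t \<Longrightarrow> \<theta> z t = t"
    and le_t: "\<And>z t. z \<in> U \<Longrightarrow> t \<le> h z \<Longrightarrow> \<theta> z t \<le> h z"
  shows "slide c d G \<theta> y \<in> topspace Y"
proof (cases "fst y \<in> K")
  case False
  then show ?thesis using slide_id_outside[OF y False, of \<theta>] fix_t y by simp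
next
  case True
  then obtain x t where xt: "x \<in> A" "0 \<le> t" "t \<le> h x" "fst y = c (x, t)" unfolding K by auto
  have xU: "x \<in> U" using xt A by blast
  have "t < 1" using xt(3) h(2)[OF xU] by simp
  then have G: "fst y \<in> G" "d (fst y) = (x, t)" using cG[OF xU xt(2)] xt(4) by auto
  let ?t = "\<theta> x (t + snd y)"
  have "snd y \<le> 0" using y by (auto simp: top_Y)
  then have le: "?t \<le> h x" using le_t[OF xU] xt(3) by simp
  have eq: "slide c d G \<theta> y = (c (x, max ?t 0), min ?t 0)" using G by (simp add: slide_def Let_def)
  have "K \<subseteq> S" using K_closed closedin_subset by fastforce
  show ?thesis
  proof (cases "?t \<le> 0")
    case True
    then show ?thesis using eq c0[OF xU] xU U by (auto simp: top_Y max_def min_def)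
  next
    case False
    then have "c (x, ?t) \<in> K" unfolding K using le xt by auto
    then show ?thesis using eq \<open>K \<subseteq> S\<close> False by (auto simp: top_Y max_def min_def)
  qed
qed

text \<open>The slide is continuous over \<open>G\<close> by its coordinate formula, and over the complement of \<open>K\<close> because it
  is the identity there. Closedness of \<open>K\<close> in \<open>S\<close> makes these two pieces an open cover.\<close>

lemma continuous_map_slide:
  assumes cont: "continuous_map (prod_topology (subtopology X U) euclideanreal) euclideanreal (\<lambda>p. \<theta> (fst p) (snd p))"
    and fix_t: "\<And>z t. z \<in> U \<Longrightarrow> z \<notin> A \<or> h z \<le> t \<Longrightarrow> \<theta> z t = t"
    and le_t: "\<And>z t. z \<in> U \<Longrightarrow> t \<le> h z \<Longrightarrow> \<theta> z t \<le> h z"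
  shows "continuous_map Y Y (slide c d G \<theta>)"
proof -
  let ?P = "prod_topology X euclideanreal"
  have "continuous_map Y ?P (slide c d G \<theta>)"
  proof (rule pasting_lemma[where I="UNIV :: bool set" and f="\<lambda>b. if b then slide c d G \<theta> else id"
        and T="\<lambda>b. {y \<in> topspace Y. fst y \<in> (if b then G else S - K)}"])
    have fstY: "continuous_map Y X fst"
      unfolding outer_extension_def by (intro continuous_map_from_subtopology continuous_map_fst)
    have sndY: "continuous_map Y euclideanreal snd"
      unfolding outer_extension_def by (intro continuous_map_from_subtopology continuous_map_snd)
    have SK: "openin X (S - K)"
      using K_closed S by (metis closedin_def openin_trans_full topspace_subtopology_subset openin_subset)
    show "openin Y {y \<in> topspace Y. fst y \<in> (if b then G else S - K)}" for b
    proof (rule openin_continuous_map_preimage[OF fstY])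
      show "openin X (if b then G else S - K)" using G SK by simp
    qed
    show "continuous_map (subtopology Y {y \<in> topspace Y. fst y \<in> (if b then G else S - K)}) ?P
            (if b then slide c d G \<theta> else id)" for b
    proof (cases b)
      case False
      then show ?thesis unfolding outer_extension_def
        by (auto intro: continuous_map_from_subtopology)
    next
      case True
      let ?T = "subtopology Y {y \<in> topspace Y. fst y \<in> G}"
      have fT: "continuous_map ?T (subtopology X G) fst"
        using fstY by (auto simp: continuous_map_in_subtopology intro: continuous_map_from_subtopology)
      have dc: "continuous_map (subtopology X G) (prod_topology (subtopology X U) (top_of_set {0..<1})) d"
        using homeo by (simp add: homeomorphic_maps_def)
      have zc: "continuous_map ?T (subtopology X U) (\<lambda>y. fst (d (fst y)))"
        using continuous_map_compose[OF continuous_map_compose[OF fT dc] continuous_map_fst]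
        by (simp add: o_def)
      have tc: "continuous_map ?T euclideanreal (\<lambda>y. snd (d (fst y)))"
        using continuous_map_compose[OF continuous_map_compose[OF fT dc] continuous_map_snd]
        by (simp add: o_def continuous_map_in_subtopology)
      have sc: "continuous_map ?T euclideanreal (\<lambda>y. snd (d (fst y)) + snd y)"
        by (intro continuous_map_add tc continuous_map_from_subtopology[OF sndY])
      let ?\<theta> = "\<lambda>y. \<theta> (fst (d (fst y))) (snd (d (fst y)) + snd y)"
      have \<theta>c: "continuous_map ?T euclideanreal ?\<theta>"
        using continuous_map_compose[OF continuous_map_pairedI[OF zc sc] cont] by (simp add: o_def)
      have \<theta>1: "?\<theta> y < 1" if "y \<in> topspace ?T" for y
      proof -
        have y: "fst (d (fst y)) \<in> U" "snd (d (fst y)) < 1" "snd y \<le> 0"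
          using that dG[of "fst y"] by (auto simp: top_Y)
        show ?thesis
        proof (cases "snd (d (fst y)) + snd y \<le> h (fst (d (fst y)))")
          case True
          then show ?thesis using le_t[OF y(1) True] h(2)[OF y(1)] by simp
        next
          case False
          then show ?thesis using fix_t[OF y(1), of "snd (d (fst y)) + snd y"] y by simp
        qed
      qed
      have mc: "continuous_map ?T (top_of_set {0..<1}) (\<lambda>y. max (?\<theta> y) 0)"
        using \<theta>c \<theta>1 by (auto simp: continuous_map_in_subtopology intro!: continuous_intros)
      have cc: "continuous_map (prod_topology (subtopology X U) (top_of_set {0..<1})) X c"
        using homeo by (simp add: homeomorphic_maps_def continuous_map_in_subtopology)
      have "continuous_map ?T ?P (\<lambda>y. (c (fst (d (fst y)), max (?\<theta> y) 0), min (?\<theta> y) 0))"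
        using continuous_map_compose[OF continuous_map_pairedI[OF zc mc] cc] \<theta>c
        by (intro continuous_map_pairedI continuous_intros) (auto simp: o_def)
      then have "continuous_map ?T ?P (slide c d G \<theta>)"
        by (rule continuous_map_eq) (auto simp: slide_def Let_def)
      then show ?thesis using True by simp
    qed
    have out: "slide c d G \<theta> y = y" if "y \<in> topspace Y" "fst y \<notin> K" for y
      using slide_id_outside[OF that] fix_t by blast
    show "(if i then slide c d G \<theta> else id) y = (if j then slide c d G \<theta> else id) y"
      if "y \<in> topspace Y \<inter> {y \<in> topspace Y. fst y \<in> (if i then G else S - K)} \<inter> 
            {y \<in> topspace Y. fst y \<in> (if j then G else S - K)}" for i j y
      using that out[of y] by (auto split: if_splits)
    show "\<exists>j. j \<in> UNIV \<and> y \<in> {y \<in> topspace Y. fst y \<in> (if j then G else S - K)} \<and>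
            slide c d G \<theta> y = (if j then slide c d G \<theta> else id) y"
      if "y \<in> topspace Y" for y
    proof (cases "fst y \<in> K")
      case True
      then have "fst y \<in> G" using cG A h by (force simp: K)
      then show ?thesis using that by (intro exI[of _ True]) auto
    next
      case False
      then show ?thesis using that out[OF that False] B by (intro exI[of _ False]) (auto simp: top_Y)
    qed
  qed
  moreover have "slide c d G \<theta> ` topspace Y \<subseteq> topspace Y"
    using slide_in fix_t le_t by blast
  ultimately show ?thesis
    by (auto simp: outer_extension_def continuous_map_in_subtopology)
qed

lemma slide_slide:
  assumes y: "y \<in> topspace Y"
    and lt: "\<And>z t. z \<in> U \<Longrightarrow> t < 1 \<Longrightarrow> \<theta> z t < 1"
    and inv: "\<And>z t. z \<in> U \<Longrightarrow> \<theta>' z (\<theta> z t) = t"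
  shows "slide c d G \<theta>' (slide c d G \<theta> y) = y"
proof (cases "fst y \<in> G")
  case False
  then show ?thesis by (simp add: slide_def)
next
  case G: True
  let ?z = "fst (d (fst y))" and ?s = "snd (d (fst y)) + snd y"
  have z: "?z \<in> U" "snd (d (fst y)) < 1" "snd y \<le> 0" using dG[OF G] y by (auto simp: top_Y)
  then have "max (\<theta> ?z ?s) 0 < 1" using lt[OF z(1), of ?s] by simp
  then have c: "c (?z, max (\<theta> ?z ?s) 0) \<in> G" "d (c (?z, max (\<theta> ?z ?s) 0)) = (?z, max (\<theta> ?z ?s) 0)"
    using cG[OF z(1), of "max (\<theta> ?z ?s) 0"] by auto
  have max_min: "max r 0 + min r 0 = r" for r :: real by (simp add: max_def min_def)
  have "slide c d G \<theta>' (slide c d G \<theta> y) = slide c d G (\<lambda>z t. t) y"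
    using G c inv[OF z(1)] max_min by (simp add: slide_def Let_def)
  also have "\<dots> = y" by (rule slide_fixes[OF y]) simp
  finally show ?thesis .
qed

text \<open>The slide determined by \<open>stretch (a z) (h z)\<close>. On the cylinder over \<open>A\<close> it translates the part below
  level \<open>-a\<close> and carries the rest into \<open>S\<close>; points of \<open>S\<close> stay in \<open>S\<close>.\<close>

lemma push_exists:
  assumes a: "continuous_map (subtopology X U) euclideanreal a" "\<And>x. x \<in> U \<Longrightarrow> 0 \<le> a x"
      "\<And>x. x \<in> U - A \<Longrightarrow> a x = 0"
    and hc: "continuous_map (subtopology X U) euclideanreal h"
  obtains k where "homeomorphic_map Y Y k"
    "\<And>y. y \<in> topspace Y \<Longrightarrow> fst y \<notin> K \<Longrightarrow> k y = y"
    "\<And>x t. x \<in> A \<Longrightarrow> t \<le> - a x \<Longrightarrow> k (x, t) = (x, t + a x)"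
    "\<And>x t. x \<in> A \<Longrightarrow> - a x \<le> t \<Longrightarrow> t \<le> 0 \<Longrightarrow> snd (k (x, t)) = 0"
    "\<And>x. x \<in> S \<Longrightarrow> snd (k (x, 0)) = 0"
proof -
  let ?f = "\<lambda>z t. stretch (a z) (h z) t" and ?g = "\<lambda>z t. unstretch (a z) (h z) t"
  let ?P = "prod_topology (subtopology X U) euclideanreal"
  have ac: "continuous_map ?P euclideanreal (\<lambda>p. a (fst p))"
    using continuous_map_compose[OF continuous_map_fst a(1)] by (simp add: o_def)
  have hc': "continuous_map ?P euclideanreal (\<lambda>p. h (fst p))"
    using continuous_map_compose[OF continuous_map_fst hc] by (simp add: o_def)
  have sc: "continuous_map ?P euclideanreal snd" by (rule continuous_map_snd)
  have fc: "continuous_map ?P euclideanreal (\<lambda>p. ?f (fst p) (snd p))"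
    unfolding stretch_def using ac hc' sc a(2) h(1)
    by (intro continuous_intros) (force simp: add_pos_nonneg add_nonneg_eq_0_iff)+
  have gc: "continuous_map ?P euclideanreal (\<lambda>p. ?g (fst p) (snd p))"
    unfolding unstretch_def using ac hc' sc h(1)
    by (intro continuous_intros) force+
  have ffix: "?f z t = t" and gfix: "?g z t = t" if "z \<in> U" "z \<notin> A \<or> h z \<le> t" for z t
    using that a(2)[of z] a(3)[of z] h(1)[of z] by (auto simp: stretch_eq unstretch_eq)
  have fle: "?f z t \<le> h z" if "z \<in> U" "t \<le> h z" for z t
    using that a(2)[of z] h(1)[of z] by (intro stretch_le) auto
  have gle: "?g z t \<le> t" for z t by (simp add: unstretch_def)
  have flt: "?f z t < 1" if "z \<in> U" "t < 1" for z t
    using ffix[OF that(1), of t] fle[OF that(1), of t] h(2)[OF that(1)] that(2)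
    by (cases "t \<le> h z") auto
  have glt: "?g z t < 1" if "t < 1" for z t using gle[of z t] that by simp
  have fg: "?f z (?g z t) = t" and gf: "?g z (?f z t) = t" if "z \<in> U" for z t
    using stretch_unstretch[OF a(2)[OF that] h(1)[OF that]] by auto
  define k where "k = slide c d G ?f"
  show thesis
  proof
    have "homeomorphic_maps Y Y k (slide c d G ?g)"
      unfolding homeomorphic_maps_def k_def
    proof (intro conjI ballI)
      show "continuous_map Y Y (slide c d G ?f)"
        by (rule continuous_map_slide[OF fc]) (use ffix fle in auto)
      show "continuous_map Y Y (slide c d G ?g)"
        by (rule continuous_map_slide[OF gc]) (use gfix gle order_trans in \<open>blast+\<close>)
      show "slide c d G ?g (slide c d G ?f y) = y" if "y \<in> topspace Y" for y
        by (rule slide_slide[OF that]) (use flt gf in auto)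
      show "slide c d G ?f (slide c d G ?g y) = y" if "y \<in> topspace Y" for y
        by (rule slide_slide[OF that]) (use glt fg in auto)
    qed
    then show "homeomorphic_map Y Y k" using homeomorphic_map_maps by blast
    show "k y = y" if "y \<in> topspace Y" "fst y \<notin> K" for y
      unfolding k_def by (rule slide_id_outside[OF that]) (use ffix in auto)
    have kU: "k (x, t) = (c (x, max (?f x t) 0), min (?f x t) 0)" if "x \<in> U" for x t
      using UG[OF that] by (simp add: k_def slide_def Let_def)
    show "k (x, t) = (x, t + a x)" if "x \<in> A" "t \<le> - a x" for x t
    proof -
      have x: "x \<in> U" using that A by blast
      have "?f x t = t + a x" using that(2) a(2)[OF x] h(1)[OF x] by (simp add: stretch_eq)
      then show ?thesis using kU[OF x] that(2) c0[OF x] by simp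
    qed
    show "snd (k (x, t)) = 0" if "x \<in> A" "- a x \<le> t" "t \<le> 0" for x t
    proof -
      have x: "x \<in> U" using that A by blast
      then show ?thesis using kU[OF x] stretch_nonneg[OF a(2)[OF x] h(1)[OF x] that(2)] by simp
    qed
    show "snd (k (x, 0)) = 0" if "x \<in> S" for x
    proof (cases "x \<in> G")
      case True
      then have "fst (d x) \<in> U" "0 \<le> snd (d x)" using dG by auto
      then have "0 \<le> ?f (fst (d x)) (snd (d x))" 
        using a(2)[of "fst (d x)"] h(1) by (intro stretch_nonneg) force+
      then show ?thesis using True by (simp add: k_def slide_def Let_def)
    qed (simp add: k_def slide_def)
  qed
qed

end

section \<open>Infinite compositions in decreasing order\<close>

text \<open>The relation \<open>descent r K k L y z\<close> says that \<open>z\<close> arises from \<open>y\<close> by applying maps \<open>k j\<close> with \<open>j \<in> L\<close> in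
  strictly decreasing order until the point lies in none of the remaining sets \<open>K j\<close>. An index may be
  skipped only if the current point lies outside its set; applying the identity at such a point is
  allowed as well, which spares a maximality condition in \<open>step\<close>.\<close>

inductive descent :: "'i rel \<Rightarrow> ('i \<Rightarrow> 'b set) \<Rightarrow> ('i \<Rightarrow> 'b \<Rightarrow> 'b) \<Rightarrow> 'i set \<Rightarrow> 'b \<Rightarrow> 'b \<Rightarrow> bool"
  for r K k where
  stop: "(\<And>j. j \<in> L \<Longrightarrow> y \<notin> K j) \<Longrightarrow> descent r K k L y y"
| step: "j \<in> L \<Longrightarrow> (\<And>l. l \<in> L \<Longrightarrow> (j, l) \<in> r \<Longrightarrow> y \<notin> K l) \<Longrightarrow>
    descent r K k {l \<in> L. (l, j) \<in> r} (k j y) z \<Longrightarrow> descent r K k L y z"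

text \<open>Passing from \<open>L\<close> to the part of \<open>L\<close> below one of its elements is well-founded, since these elements form
  a descending sequence. Inducting on sets of indices rather than on indices covers the whole index set
  without a top element.\<close>

lemma wf_initial_segment_induct:
  assumes "wf r" and step: "\<And>L. (\<And>j. j \<in> L \<Longrightarrow> P {l \<in> L. (l, j) \<in> r}) \<Longrightarrow> P L"
  shows "P L"
proof -
  have *: "P L" if "L \<subseteq> {l. (l, j) \<in> r}" for j L
    using assms(1) that
  proof (induction j arbitrary: L rule: wf_induct_rule)
    case (less j)
    show ?case
    proof (rule step)
      show "P {l \<in> L. (l, i) \<in> r}" if "i \<in> L" for i
        by (rule less.IH[of i]) (use less.prems that in auto)
    qed
  qed
  show ?thesis by (rule step, rule *) auto
qed

text \<open>Two descents from \<open>y\<close> can start at different indices \<open>j < j'\<close> only if \<open>k j'\<close> fixes \<open>y\<close>. Then the first one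
  is also a descent below \<open>j'\<close>, and the induction hypothesis applies there.\<close>

lemma descent_unique:
  assumes "wf r" "trans r" "total r" and fix_out: "\<And>j y. y \<notin> K j \<Longrightarrow> k j y = y"
    and "descent r K k L y z" "descent r K k L y z'"
  shows "z = z'"
  using assms(5,6)
proof (induction L arbitrary: y z z' rule: wf_initial_segment_induct[OF assms(1)])
  case (1 L)
  note IH = "1.IH"
  let ?D = "descent r K k"
  have stop_case: "y = w" if none: "\<And>j. j \<in> L \<Longrightarrow> y \<notin> K j" and w: "?D L y w" for w
    using w
  proof cases
    case (step j)
    then have "?D {l \<in> L. (l, j) \<in> r} y w" using none fix_out by metis
    moreover have "?D {l \<in> L. (l, j) \<in> r} y y" using none by (auto intro: descent.stop)
    ultimately show ?thesis using IH step(1) by blast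
  qed simp
  have step_case: "w = w'" if j: "j \<in> L" "\<And>l. l \<in> L \<Longrightarrow> (j, l) \<in> r \<Longrightarrow> y \<notin> K l"
      "?D {l \<in> L. (l, j) \<in> r} (k j y) w"
    and j': "j' \<in> L" "?D {l \<in> L. (l, j') \<in> r} (k j' y) w'" and lt: "(j, j') \<in> r" for j j' w w'
  proof -
    have "k j' y = y" using j(2)[OF j'(1) lt] fix_out by blast
    have eq: "{l \<in> {l \<in> L. (l, j') \<in> r}. (l, j) \<in> r} = {l \<in> L. (l, j) \<in> r}"
      using lt assms(2) by (auto dest: transD)
    have "?D {l \<in> L. (l, j') \<in> r} y w"
      by (rule descent.step[of j]) (use j lt eq in simp_all)
    moreover have "?D {l \<in> L. (l, j') \<in> r} y w'" using j'(2) \<open>k j' y = y\<close> by simp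
    ultimately show ?thesis by (rule IH[OF j'(1)])
  qed
  from "1.prems"(1) show ?case
  proof cases
    case stop
    then show ?thesis using stop_case "1.prems"(2) by metis
  next
    case (step j)
    note j = this
    from "1.prems"(2) show ?thesis
    proof cases
      case stop
      then show ?thesis using stop_case "1.prems"(1) by metis
    next
      case (step j')
      consider "j = j'" | "(j, j') \<in> r" | "(j', j) \<in> r"
        using assms(3) by (auto simp: total_on_def)
      then show ?thesis
      proof cases
        case 1
        then show ?thesis using IH[OF j(1) j(3)] step(3) by simp
      next
        case 2
        show ?thesis by (rule step_case[OF j step(1,3) 2])
      next
        case 3
        show ?thesis by (rule step_case[OF step j(1,3) 3, symmetric])
      qed
    qed
  qed
qed

lemma finite_total_has_greatest:
  assumes "trans r" "total r" "finite J" "J \<noteq> {}"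
  shows "\<exists>m\<in>J. \<forall>l\<in>J. l = m \<or> (l, m) \<in> r"
  using assms(3,4)
proof (induction rule: finite_ne_induct)
  case (insert x F)
  then obtain m where m: "m \<in> F" "\<forall>l\<in>F. l = m \<or> (l, m) \<in> r" by blast
  consider "x = m" | "(x, m) \<in> r" | "(m, x) \<in> r" using assms(2) by (auto simp: total_on_def)
  then show ?case
  proof cases
    case 3
    then have "\<forall>l\<in>insert x F. l = x \<or> (l, x) \<in> r" using m assms(1) by (auto dest: transD)
    then show ?thesis by blast
  qed (use m in auto)
qed auto

text \<open>Properties of pairs of a set of pending indices and a current point that survive dropping inactive
  indices and applying an active one. They carry over from the start of a descent to its end, where no index is pending.\<close>

definition descent_invariant ::
  "'b topology \<Rightarrow> 'i set \<Rightarrow> ('i \<Rightarrow> 'b set) \<Rightarrow> ('i \<Rightarrow> 'b \<Rightarrow> 'b) \<Rightarrow> ('i set \<Rightarrow> 'b \<Rightarrow> bool) \<Rightarrow> bool" where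
  "descent_invariant Y I K k Q \<longleftrightarrow>
     (\<forall>y\<in>topspace Y. \<forall>J\<subseteq>I. Q J y \<longrightarrow>
        (\<forall>J'\<subseteq>J. (\<forall>j\<in>J - J'. y \<notin> K j) \<longrightarrow> Q J' y) \<and>
        (\<forall>j\<in>J. y \<in> K j \<longrightarrow> Q (J - {j}) (k j y)))"

text \<open>The composition of all \<open>k j\<close> in decreasing well-order. Near a finite set of points only finitely many
  of the sets \<open>K j\<close> matter; after the largest of them has acted, the induction hypothesis for the smaller
  indices applies to the moved points. So on a neighbourhood of any finite set the composition agrees
  with a homeomorphism. One-point sets yield continuity and openness, two-point sets injectivity.\<close>

lemma locally_finite_composition:
  fixes Y :: "'b topology" and k :: "'i \<Rightarrow> 'b \<Rightarrow> 'b" and K :: "'i \<Rightarrow> 'b set"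
  assumes homeo: "\<And>j. j \<in> I \<Longrightarrow> homeomorphic_map Y Y (k j)"
    and fix_out: "\<And>j y. j \<in> I \<Longrightarrow> y \<in> topspace Y \<Longrightarrow> y \<notin> K j \<Longrightarrow> k j y = y"
    and lf: "\<And>y. y \<in> topspace Y \<Longrightarrow> \<exists>N. openin Y N \<and> y \<in> N \<and> finite {j\<in>I. K j \<inter> N \<noteq> {}}"
  shows "\<exists>E. continuous_map Y Y E \<and> open_map Y Y E \<and> inj_on E (topspace Y) \<and>
      (\<forall>Q y. descent_invariant Y I K k Q \<longrightarrow> y \<in> topspace Y \<longrightarrow> Q I y \<longrightarrow> Q {} (E y))"
proof -
  obtain r0 :: "'i rel" where "well_order_on UNIV r0" using well_order_on by blast
  define r where "r = r0 - Id"
  have wf: "wf r" and tot: "total r" and trans: "trans r" and irr: "irrefl r"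
  proof -
    have *: "linear_order_on UNIV r0" "wf (r0 - Id)"
      using \<open>well_order_on UNIV r0\<close> by (auto simp: well_order_on_def)
    show "wf r" using * by (simp add: r_def)
    show "total r" "irrefl r" "trans r" using *(1)
      by (auto simp: r_def linear_order_on_def partial_order_on_def preorder_on_def trans_diff_Id
          irrefl_def)
  qed
  have asym: "(a, b) \<notin> r" if "b = a \<or> (b, a) \<in> r" for a b
    using that trans irr by (auto simp: irrefl_def dest: transD)
  \<comment> \<open>Outside \<open>K j\<close> the map \<open>k j\<close> is the identity only on the space;
    making it so everywhere lets descents be unique for all points.\<close>
  define k' where "k' j y = (if y \<in> K j then k j y else y)" for j y
  have k'_eq: "k' j y = k j y" if "j \<in> I" "y \<in> topspace Y" for j y
    using fix_out that by (auto simp: k'_def)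
  have homeo': "homeomorphic_map Y Y (k' j)" if "j \<in> I" for j
    using homeo[OF that] k'_eq[OF that] by (metis homeomorphic_map_eq)
  have k'_in: "k' j y \<in> topspace Y" if "j \<in> I" "y \<in> topspace Y" for j y
    using homeo'[OF that(1)] that(2) homeomorphic_imp_surjective_map by blast
  let ?D = "descent r K k'"
  have fin: "finite {j\<in>L. y \<in> K j}" if L: "L \<subseteq> I" "y \<in> topspace Y" for L y
  proof -
    obtain N where "y \<in> N" "finite {j\<in>I. K j \<inter> N \<noteq> {}}" using lf[OF L(2)] by blast
    then show ?thesis using L(1) by (elim rev_finite_subset) auto
  qed
  have ex: "\<exists>z. ?D L y z" if "L \<subseteq> I" "y \<in> topspace Y" for L y
    using that
  proof (induction L arbitrary: y rule: wf_initial_segment_induct[OF wf])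
    case (1 L)
    show ?case
    proof (cases "{j\<in>L. y \<in> K j} = {}")
      case True
      then show ?thesis by (auto intro: descent.stop)
    next
      case False
      then obtain m where m: "m \<in> L" "y \<in> K m" "\<And>l. l \<in> L \<Longrightarrow> y \<in> K l \<Longrightarrow> l = m \<or> (l, m) \<in> r"
        using finite_total_has_greatest[OF trans tot fin[OF "1.prems"] False] by auto
      obtain z where z: "?D {l \<in> L. (l, m) \<in> r} (k' m y) z"
        using "1.IH"[OF m(1), of "k' m y"] "1.prems" m(1) k'_in by blast
      have "y \<notin> K l" if "l \<in> L" "(m, l) \<in> r" for l
        using m(3)[OF that(1)] that(2) asym by blast
      then have "?D L y z" using z by (rule descent.step[OF m(1)])
      then show ?thesis by blast
    qed
  qed
  define F where "F L y = (THE z. ?D L y z)" for L y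
  have uniq: "z = z'" if "?D L y z" "?D L y z'" for L y z z'
    by (rule descent_unique[OF wf trans tot _ that]) (simp add: k'_def)
  have F_eq: "F L y = z" if "?D L y z" for L y z
    unfolding F_def using that uniq by (intro the_equality) auto
  have F_stop: "F L y = y" if "\<And>j. j \<in> L \<Longrightarrow> y \<notin> K j" for L y
    using that by (intro F_eq descent.stop)
  have F_step: "F L y = F {l\<in>L. (l, j) \<in> r} (k' j y)"
    if L: "L \<subseteq> I" "y \<in> topspace Y" "j \<in> L" "\<And>l. l \<in> L \<Longrightarrow> (j, l) \<in> r \<Longrightarrow> y \<notin> K l" for L y j
  proof -
    obtain z where z: "?D {l\<in>L. (l, j) \<in> r} (k' j y) z"
      using ex[of "{l\<in>L. (l, j) \<in> r}" "k' j y"] L k'_in by blast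
    have "?D L y z" by (rule descent.step[OF L(3) _ z]) (rule L(4))
    then show ?thesis using F_eq z by metis
  qed
  \<comment> \<open>The induction works for finite sets \<open>P\<close> because the images of \<open>P\<close>
    under one map form a finite set again.\<close>
  have local_homeo: "\<exists>N g. openin Y N \<and> P \<subseteq> N \<and> homeomorphic_map Y Y g \<and> (\<forall>y\<in>N. F L y = g y)"
    if "L \<subseteq> I" "finite P" "P \<subseteq> topspace Y" for L P
    using that
  proof (induction L arbitrary: P rule: wf_initial_segment_induct[OF wf])
    case (1 L)
    obtain N0 where N0: "\<And>y. y \<in> P \<Longrightarrow> openin Y (N0 y) \<and> y \<in> N0 y \<and> finite {j\<in>I. K j \<inter> N0 y \<noteq> {}}"
      using lf "1.prems"(3) by (metis in_mono)
    define N where "N = \<Union>(N0 ` P)"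
    have N: "openin Y N" "P \<subseteq> N" unfolding N_def using N0 by auto
    have NY: "N \<subseteq> topspace Y" using N(1) openin_subset by blast
    have finN: "finite {j\<in>L. K j \<inter> N \<noteq> {}}"
    proof (rule finite_subset)
      show "{j\<in>L. K j \<inter> N \<noteq> {}} \<subseteq> (\<Union>y\<in>P. {j\<in>I. K j \<inter> N0 y \<noteq> {}})"
        using "1.prems"(1) by (auto simp: N_def)
      show "finite (\<Union>y\<in>P. {j\<in>I. K j \<inter> N0 y \<noteq> {}})"
        using "1.prems"(2) N0 by auto
    qed
    show ?case
    proof (cases "{j\<in>L. K j \<inter> N \<noteq> {}} = {}")
      case True
      have "F L y = id y" if "y \<in> N" for y
        unfolding id_apply by (rule F_stop) (use True that in blast)
      moreover have "homeomorphic_map Y Y id" by simp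
      ultimately show ?thesis using N by blast
    next
      case False
      then obtain m where m: "m \<in> L" "\<And>l. l \<in> L \<Longrightarrow> K l \<inter> N \<noteq> {} \<Longrightarrow> l = m \<or> (l, m) \<in> r"
        using finite_total_has_greatest[OF trans tot finN False] by auto
      let ?L = "{l\<in>L. (l, m) \<in> r}"
      have mI: "m \<in> I" using m "1.prems" by blast
      obtain N' g where g: "openin Y N'" "k' m ` P \<subseteq> N'" "homeomorphic_map Y Y g" "\<forall>y\<in>N'. F ?L y = g y"
        using "1.IH"[OF m(1), of "k' m ` P"] "1.prems" k'_in[OF mI] by blast
      have "openin Y {y \<in> topspace Y. k' m y \<in> N'}"
        using homeo'[OF mI] g(1) homeomorphic_imp_continuous_map openin_continuous_map_preimage by metis
      then have "openin Y (N \<inter> {y \<in> topspace Y. k' m y \<in> N'})" using N(1) by blast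
      moreover have "P \<subseteq> N \<inter> {y \<in> topspace Y. k' m y \<in> N'}" using N(2) g(2) "1.prems"(3) by auto
      moreover have "homeomorphic_map Y Y (g \<circ> k' m)"
        using homeo'[OF mI] g(3) homeomorphic_map_compose by blast
      moreover have "F L y = (g \<circ> k' m) y" if "y \<in> N" "k' m y \<in> N'" for y
      proof -
        have "y \<notin> K l" if "l \<in> L" "(m, l) \<in> r" for l
          using m(2)[OF that(1)] that(2) \<open>y \<in> N\<close> asym by blast
        then have "F L y = F ?L (k' m y)" using F_step[OF "1.prems"(1) _ m(1)] NY \<open>y \<in> N\<close> by blast
        then show ?thesis using g(4) that by simp
      qed
      ultimately show ?thesis by blast
    qed
  qed
  have loc1: "\<exists>N g. openin Y N \<and> y \<in> N \<and> homeomorphic_map Y Y g \<and> (\<forall>y\<in>N. F I y = g y)"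
    if "y \<in> topspace Y" for y
    using local_homeo[of I "{y}"] that by auto
  then obtain N g where Ng: "\<And>y. y \<in> topspace Y \<Longrightarrow> openin Y (N y) \<and> y \<in> N y \<and> 
      homeomorphic_map Y Y (g y) \<and> (\<forall>x\<in>N y. F I x = g y x)"
    by metis
  show ?thesis
  proof (intro exI[of _ "F I"] conjI allI impI)
    show "continuous_map Y Y (F I)"
    proof (rule pasting_lemma[where I="topspace Y" and T=N and f=g])
      show "continuous_map (subtopology Y (N i)) Y (g i)" if "i \<in> topspace Y" for i
        using Ng[OF that] homeomorphic_imp_continuous_map continuous_map_from_subtopology by blast
      show "openin Y (N i)" if "i \<in> topspace Y" for i using Ng[OF that] by blast
      show "g i x = g j x"
        if "i \<in> topspace Y" "j \<in> topspace Y" "x \<in> topspace Y \<inter> N i \<inter> N j" for i j x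
      proof -
        have "F I x = g i x" "F I x = g j x" using Ng[OF that(1)] Ng[OF that(2)] that(3) by auto
        then show ?thesis by simp
      qed
      show "\<exists>j. j \<in> topspace Y \<and> x \<in> N j \<and> F I x = g j x" if "x \<in> topspace Y" for x
        using Ng[OF that] that by blast
    qed
    show "open_map Y Y (F I)"
      unfolding open_map_def
    proof (intro allI impI)
      fix U assume U: "openin Y U"
      then have UY: "U \<subseteq> topspace Y" using openin_subset by blast
      have "F I ` (U \<inter> N y) = g y ` (U \<inter> N y)" if "y \<in> U" for y
        using Ng UY that by (intro image_cong) auto
      moreover have "U = (\<Union>y\<in>U. U \<inter> N y)" using Ng UY by auto
      ultimately have "F I ` U = (\<Union>y\<in>U. g y ` (U \<inter> N y))"
        by (metis (no_types, lifting) SUP_cong image_UN)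
      moreover have "openin Y (g y ` (U \<inter> N y))" if "y \<in> U" for y
      proof -
        have "homeomorphic_map Y Y (g y)" "openin Y (U \<inter> N y)" using Ng that UY U by blast+
        then show ?thesis using homeomorphic_imp_open_map open_map_def by blast
      qed
      ultimately show "openin Y (F I ` U)" by auto
    qed
    show "inj_on (F I) (topspace Y)"
    proof (rule inj_onI)
      fix x y assume xy: "x \<in> topspace Y" "y \<in> topspace Y" "F I x = F I y"
      then obtain N g where "{x, y} \<subseteq> N" "homeomorphic_map Y Y g" "\<forall>y\<in>N. F I y = g y"
        using local_homeo[of I "{x, y}"] by auto
      then have "g x = g y" "inj_on g (topspace Y)"
        using xy homeomorphic_imp_injective_map by auto
      then show "x = y" using xy by (auto dest: inj_onD)
    qed
    fix Q y
    assume "descent_invariant Y I K k Q" "y \<in> topspace Y" "Q I y"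
    then have skip: "Q J' y" if "Q J y" "y \<in> topspace Y" "J \<subseteq> I" "J' \<subseteq> J" "\<And>j. j \<in> J - J' \<Longrightarrow> y \<notin> K j" for J J' y
      using that unfolding descent_invariant_def by blast
    have act: "Q (J - {j}) (k j y)" if "Q J y" "y \<in> topspace Y" "J \<subseteq> I" "j \<in> J" "y \<in> K j" for J j y
      using \<open>descent_invariant Y I K k Q\<close> that unfolding descent_invariant_def by blast
    have "Q {} z" if "?D L y z" "Q L y" "L \<subseteq> I" "y \<in> topspace Y" for L y z
      using that
    proof induction
      case (stop L y)
      then show ?case using skip[of L y "{}"] by blast
    next
      case (step j L y z)
      have jI: "j \<in> I" using step by blast
      have "Q {l\<in>L. l = j \<or> (l, j) \<in> r} y"
      proof (rule skip[OF step.prems(1,3,2)])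
        show "y \<notin> K l" if "l \<in> L - {l\<in>L. l = j \<or> (l, j) \<in> r}" for l
          using that step.hyps(2)[of l] tot by (auto simp: total_on_def)
      qed auto
      moreover have "{l\<in>L. l = j \<or> (l, j) \<in> r} - {j} = {l\<in>L. (l, j) \<in> r}"
        using irr by (auto simp: irrefl_def)
      ultimately have "Q {l\<in>L. (l, j) \<in> r} (k' j y)"
        using act[of "{l\<in>L. l = j \<or> (l, j) \<in> r}" y j] skip[of "{l\<in>L. l = j \<or> (l, j) \<in> r}" y "{l\<in>L. (l, j) \<in> r}"]
          step.prems step.hyps(1) by (cases "y \<in> K j") (auto simp: k'_def)
      then show ?case using step.IH step.prems k'_in[OF jI] by blast
    qed
    moreover obtain z where "?D I y z" using ex \<open>y \<in> topspace Y\<close> by blast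
    ultimately show "Q {} (F I y)" using F_eq \<open>y \<in> topspace Y\<close> \<open>Q I y\<close> by blast
  qed
qed

section \<open>From the outer cylinder to a collar\<close>

lemma embedding_map_restrict:
  assumes "embedding_map X Y f"
  shows "embedding_map (subtopology X S) Y f"
proof -
  have h: "homeomorphic_map X (subtopology Y (f ` topspace X)) f"
    using assms by (simp add: embedding_map_def)
  have sub: "f ` topspace X \<subseteq> topspace Y"
    using homeomorphic_imp_surjective_map[OF h] by (metis inf_le1 topspace_subtopology)
  have "homeomorphic_map (subtopology X S)
      (subtopology (subtopology Y (f ` topspace X)) (f ` (topspace X \<inter> S))) f"
    by (rule homeomorphic_map_subtopologies[OF h], unfold topspace_subtopology) (use sub in blast)
  moreover have "f ` topspace X \<inter> f ` (topspace X \<inter> S) = f ` topspace (subtopology X S)"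
    unfolding topspace_subtopology by blast
  ultimately show ?thesis by (simp add: embedding_map_def subtopology_subtopology)
qed

text \<open>Restricting a local collar to the open set \<open>U\<close> and to heights below \<open>1\<close> gives a homeomorphism onto an
  open subset of the space.\<close>

lemma local_collar_chart:
  assumes "closedin X B" "local_collar X B U c"
  obtains d where "homeomorphic_maps (prod_topology (subtopology X U) (top_of_set {0..<1}))
      (subtopology X (c ` (U \<times> {0..<1}))) c d"
    "openin X (c ` (U \<times> {0..<1}))" "U \<subseteq> B"
    "\<And>x. x \<in> U \<Longrightarrow> c (x, 0) = x"
    "\<And>x t. x \<in> U \<Longrightarrow> t \<in> {0..<1} \<Longrightarrow> c (x, t) \<in> B \<Longrightarrow> t = 0"
proof -
  let ?P = "prod_topology (subtopology X (X closure_of U)) (top_of_set {0..1::real})"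
  have U: "U \<subseteq> B" "U \<subseteq> topspace X"
    using assms(2) openin_subset unfolding local_collar_def by fastforce+
  then have cl: "U \<subseteq> X closure_of U" by (simp add: closure_of_subset)
  have emb: "embedding_map ?P X c" and c0: "\<forall>x \<in> X closure_of U. c (x, 0) = x"
    and cB: "{p \<in> (X closure_of U) \<times> {0..1}. c p \<in> B} = (X closure_of U) \<times> {0}"
    and op: "openin X (c ` (U \<times> {0..<1}))"
    using assms(2) unfolding local_collar_def by auto
  have "subtopology ?P (U \<times> {0..<1}) = prod_topology (subtopology X U) (top_of_set {0..<1})"
  proof -
    have "X closure_of U \<inter> U = U" "{0..1} \<inter> {0..<1} = {0..<1::real}" using cl by auto
    then show ?thesis by (simp add: subtopology_Times subtopology_subtopology)
  qed
  with embedding_map_restrict[OF emb, of "U \<times> {0..<1}"]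
  have "embedding_map (prod_topology (subtopology X U) (top_of_set {0..<1})) X c" by simp
  moreover have "topspace X \<inter> U = U" using U by blast
  ultimately have "homeomorphic_map (prod_topology (subtopology X U) (top_of_set {0..<1}))
      (subtopology X (c ` (U \<times> {0..<1}))) c"
    by (simp add: embedding_map_def)
  then obtain d where "homeomorphic_maps (prod_topology (subtopology X U) (top_of_set {0..<1}))
      (subtopology X (c ` (U \<times> {0..<1}))) c d"
    unfolding homeomorphic_map_maps by blast
  moreover have "t = 0" if "x \<in> U" "t \<in> {0..<1}" "c (x, t) \<in> B" for x t
  proof -
    have "(x, t) \<in> {p \<in> (X closure_of U) \<times> {0..1}. c p \<in> B}" using that cl by auto
    then show ?thesis unfolding cB by simp
  qed
  ultimately show thesis using that op U(1) c0 cl by blast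
qed

text \<open>The collar is the cylinder between the levels \<open>-1\<close> and \<open>-1/2\<close>, carried into \<open>S\<close> by \<open>E\<close>. The part between
  \<open>-1\<close> and \<open>0\<close> is embedded as an open set, because below level \<open>-1\<close> the map \<open>E\<close> stays outside \<open>S\<close>: the
  image of an open subset of the cylinder meets \<open>S\<close> only in the image of its part above \<open>-1\<close>.\<close>

lemma collared_in_of_outer_extension:
  assumes S: "openin X S" "B \<subseteq> S" and B: "closedin X B"
    and E: "continuous_map (outer_extension X S B) (outer_extension X S B) E"
      "open_map (outer_extension X S B) (outer_extension X S B) E"
      "inj_on E (topspace (outer_extension X S B))"
    and low: "\<And>x s. x \<in> B \<Longrightarrow> s \<le> -1 \<Longrightarrow> E (x, s) = (x, s + 1)"
    and high: "\<And>x s. x \<in> B \<Longrightarrow> -1 \<le> s \<Longrightarrow> s \<le> 0 \<Longrightarrow> snd (E (x, s)) = 0"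
  shows "collared_in X B"
proof -
  let ?Y = "outer_extension X S B"
  have BX: "B \<subseteq> topspace X" using S openin_subset by blast
  have top_Y: "topspace ?Y = S \<times> {0} \<union> B \<times> {..0}"
    using openin_subset[OF S(1)] S(2) by (auto simp: outer_extension_def)
  define g where "g p = fst (E (fst p, snd p / 2 - 1))" for p :: "'a \<times> real"
  let ?P = "prod_topology (subtopology X B) (top_of_set {0..<2::real})"
  have top_P: "topspace ?P = B \<times> {0..<2}" using BX by auto
  have Eg: "E (fst p, snd p / 2 - 1) = (g p, 0)" if "p \<in> B \<times> {0..<2}" for p
    using high[of "fst p" "snd p / 2 - 1"] that by (auto simp: g_def prod_eq_iff)
  have ic: "continuous_map ?P ?Y (\<lambda>p. (fst p, snd p / 2 - 1))"
  proof -
    have "continuous_map ?P X fst"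
      using continuous_map_fst continuous_map_in_subtopology by blast
    moreover have "continuous_map ?P euclideanreal snd"
      using continuous_map_snd continuous_map_in_subtopology by blast
    ultimately show ?thesis
      unfolding outer_extension_def continuous_map_in_subtopology
      by (intro conjI continuous_map_pairedI continuous_intros) auto
  qed
  have g_cont: "continuous_map ?P X g"
  proof -
    have "continuous_map ?Y X fst"
      unfolding outer_extension_def by (intro continuous_map_from_subtopology continuous_map_fst)
    from continuous_map_compose[OF continuous_map_compose[OF ic E(1)] this]
    show ?thesis by (simp add: o_def g_def[abs_def])
  qed
  have g_inj: "inj_on g (B \<times> {0..<2})"
  proof (rule inj_onI)
    fix p q assume pq: "p \<in> B \<times> {0..<2}" "q \<in> B \<times> {0..<2}" "g p = g q"
    then have "E (fst p, snd p / 2 - 1) = E (fst q, snd q / 2 - 1)" using Eg by simp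
    then have "(fst p, snd p / 2 - 1) = (fst q, snd q / 2 - 1)"
      by (rule inj_onD[OF E(3)]) (use pq in \<open>auto simp: top_Y\<close>)
    then show "p = q" by (simp add: prod_eq_iff)
  qed
  have g_open: "open_map ?P X g"
    unfolding open_map_def
  proof (intro allI impI)
    fix W assume "openin ?P W"
    then have "openin (subtopology (prod_topology X euclideanreal) (B \<times> {0..<2})) W"
      by (simp add: subtopology_Times)
    then obtain W' where W': "openin (prod_topology X euclideanreal) W'" "W = W' \<inter> B \<times> {0..<2}"
      unfolding openin_subtopology by blast
    \<comment> \<open>The same open set on the cylinder, continued arbitrarily below level
      \<open>-1\<close>.\<close>
    define V where "V = {y \<in> topspace ?Y. snd y \<in> {..<0}} \<inter> {y \<in> topspace ?Y. (fst y, 2 * snd y + 2) \<in> W'}"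
    have fstY: "continuous_map ?Y X fst" and sndY: "continuous_map ?Y euclideanreal snd"
      unfolding outer_extension_def
      by (intro continuous_map_from_subtopology continuous_map_fst continuous_map_snd)+
    have "openin ?Y V"
      unfolding V_def
    proof (intro openin_Int)
      show "openin ?Y {y \<in> topspace ?Y. snd y \<in> {..<0}}"
        by (rule openin_continuous_map_preimage[OF sndY]) auto
      have "continuous_map ?Y (prod_topology X euclideanreal) (\<lambda>y. (fst y, 2 * snd y + 2))"
        using fstY sndY by (intro continuous_map_pairedI continuous_intros) auto
      then show "openin ?Y {y \<in> topspace ?Y. (fst y, 2 * snd y + 2) \<in> W'}"
        using W'(1) by (rule openin_continuous_map_preimage)
    qed
    then have EV: "openin ?Y (E ` V)" using E(2) by (simp add: open_map_def)
    have jc: "continuous_map (subtopology X S) ?Y (\<lambda>x. (x, 0))"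
      unfolding outer_extension_def continuous_map_in_subtopology
      by (intro conjI continuous_map_pairedI) auto
    have "openin (subtopology X S) {x \<in> topspace (subtopology X S). (x, 0) \<in> E ` V}"
      by (rule openin_continuous_map_preimage[OF jc EV])
    moreover have "{x \<in> topspace (subtopology X S). (x, 0) \<in> E ` V} = g ` W"
    proof (intro equalityI subsetI)
      fix z assume "z \<in> {x \<in> topspace (subtopology X S). (x, 0) \<in> E ` V}"
      then obtain y where y: "y \<in> V" "(z, 0) = E y" by blast
      obtain x s where xs: "y = (x, s)" by force
      have "x \<in> B" "s < 0" "(x, 2 * s + 2) \<in> W'" using y(1) xs by (auto simp: V_def top_Y)
      moreover have "-1 \<le> s"
      proof (rule ccontr)
        assume "\<not> -1 \<le> s"
        then show False using low[OF \<open>x \<in> B\<close>, of s] y(2) xs by simp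
      qed
      ultimately have "(x, 2 * s + 2) \<in> W" "g (x, 2 * s + 2) = z"
        using W'(2) y(2) xs by (auto simp: g_def add_divide_distrib) (metis fst_conv)
      then show "z \<in> g ` W" by blast
    next
      fix z assume "z \<in> g ` W"
      then obtain x t where xt: "(x, t) \<in> W" "z = g (x, t)" by auto
      then have xt': "(x, t) \<in> B \<times> {0..<2}" "(x, t) \<in> W'" using W'(2) by auto
      have E0: "E (x, t / 2 - 1) = (z, 0)" using Eg[OF xt'(1)] xt(2) by simp
      have "(x, t / 2 - 1) \<in> V" using xt' by (auto simp: V_def top_Y)
      moreover have "z \<in> S"
      proof -
        have "(z, 0) \<in> topspace ?Y"
          using E(1) calculation E0 by (metis (no_types, lifting) IntD1 V_def continuous_map_image_subset_topspace image_subset_iff mem_Collect_eq)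
        then show ?thesis using S(2) by (auto simp: top_Y)
      qed
      moreover have "z \<in> topspace X" using \<open>z \<in> S\<close> openin_subset[OF S(1)] by blast
      ultimately show "z \<in> {x \<in> topspace (subtopology X S). (x, 0) \<in> E ` V}"
        using E0 by (force intro: image_eqI)
    qed
    ultimately have "openin (subtopology X S) (g ` W)" by simp
    then show "openin X (g ` W)" using S(1) openin_trans_full by blast
  qed
  have emb: "embedding_map ?P X g"
    using injective_open_imp_embedding_map[OF g_cont g_open] g_inj top_P by simp
  have clB: "X closure_of B = B" using B by (simp add: closure_of_closedin)
  have g0: "g (x, 0) = x" if "x \<in> B" for x using low[OF that, of "-1"] by (simp add: g_def)
  have "local_collar X B B g"
    unfolding local_collar_def clB
  proof (intro conjI)
    show "openin (subtopology X B) B" using BX by (simp add: openin_subtopology_refl)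
    have "subtopology ?P (B \<times> {0..1}) = prod_topology (subtopology X B) (top_of_set {0..1})"
    proof -
      have "{0..<2} \<inter> {0..1} = {0..1::real}" by auto
      then show ?thesis by (simp add: subtopology_Times subtopology_subtopology)
    qed
    then show "embedding_map (prod_topology (subtopology X B) (top_of_set {0..1})) X g"
      using embedding_map_restrict[OF emb, of "B \<times> {0..1}"] by simp
    show "\<forall>x\<in>B. g (x, 0) = x" using g0 by blast
    show "{p \<in> B \<times> {0..1}. g p \<in> B} = B \<times> {0}"
    proof (intro equalityI subsetI)
      fix p assume p: "p \<in> {p \<in> B \<times> {0..1}. g p \<in> B}"
      then have "g p = g (g p, 0)" using g0 by simp
      then have "p = (g p, 0)" by (rule inj_onD[OF g_inj]) (use p in auto)
      then show "p \<in> B \<times> {0}" using p by (metis (no_types, lifting) SigmaI mem_Collect_eq singletonI)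
    next
      fix p assume "p \<in> B \<times> {0::real}"
      then show "p \<in> {p \<in> B \<times> {0..1}. g p \<in> B}" using g0 by auto
    qed
    have "openin ?P (B \<times> {0..<1})"
    proof -
      have "{0..<1::real} = {0..<2} \<inter> {..<1}" by auto
      then have "openin (top_of_set {0..<2}) {0..<1::real}"
        by (metis open_lessThan openin_open_Int)
      then show ?thesis using BX by (simp add: openin_prod_Times_iff openin_subtopology_refl)
    qed
    then show "openin X (g ` (B \<times> {0..<1}))" using g_open by (simp add: open_map_def)
  qed
  then show ?thesis unfolding collared_in_def by blast
qed

section \<open>Charts near the subset\<close>

lemma chart_height:
  fixes c :: "'a \<times> real \<Rightarrow> 'a"
  assumes c: "continuous_map (prod_topology (subtopology X U) (top_of_set {0..<1})) X c"
    and U: "openin (subtopology X B) U" and W: "openin X W" and b: "b \<in> U" "c (b, 0) \<in> W"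
  shows "\<exists>N \<epsilon>. openin X N \<and> b \<in> N \<and> 0 < \<epsilon> \<and> \<epsilon> < 1 \<and>
    (\<forall>x t. x \<in> N \<inter> B \<longrightarrow> 0 \<le> t \<longrightarrow> t \<le> \<epsilon> \<longrightarrow> c (x, t) \<in> W)"
proof -
  let ?P = "prod_topology (subtopology X U) (top_of_set {0..<1::real})"
  have UX: "U \<subseteq> topspace X" using openin_subset[OF U] by auto
  define Z where "Z = {p \<in> topspace ?P. c p \<in> W}"
  have Z: "openin ?P Z"
    unfolding Z_def by (rule openin_continuous_map_preimage[OF c W])
  have "(b, 0) \<in> Z" using b UX by (auto simp: Z_def)
  from Z[unfolded openin_prod_topology_alt, rule_format, OF this]
  obtain M J where MJ: "openin (subtopology X U) M" "openin (top_of_set {0..<1}) J"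
      "b \<in> M" "0 \<in> J" "M \<times> J \<subseteq> Z"
    by auto
  obtain M' where M': "openin X M'" "M = M' \<inter> U" using MJ(1) unfolding openin_subtopology by blast
  obtain U' where U': "openin X U'" "U = U' \<inter> B" using U unfolding openin_subtopology by blast
  obtain J' where J': "open J'" "J = {0..<1} \<inter> J'" using MJ(2) unfolding openin_open by blast
  obtain e where e: "0 < e" "cball 0 e \<subseteq> J'" using J' MJ(4) open_contains_cball by blast
  show ?thesis
  proof (intro exI[of _ "M' \<inter> U'"] exI[of _ "min e (1/2)"] conjI allI impI)
    show "openin X (M' \<inter> U')" using M' U' by blast
    show "b \<in> M' \<inter> U'" using b MJ(3) M' U' by blast
    show "0 < min e (1/2)" "min e (1/2) < 1" using e by auto
    show "c (x, t) \<in> W" if "x \<in> M' \<inter> U' \<inter> B" "0 \<le> t" "t \<le> min e (1/2)" for x t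
    proof -
      have "t \<in> cball 0 e" using that by auto
      then have "t \<in> J" using that e J' by auto
      moreover have "x \<in> M" using that M' U' by blast
      ultimately show ?thesis using MJ(5) by (auto simp: Z_def)
    qed
  qed
qed

text \<open>The region is closed in the image \<open>G\<close> of the chart, as the image of a closed set. It need not be closed
  in the whole space.\<close>

lemma closedin_chart_region:
  assumes homeo: "homeomorphic_maps (prod_topology (subtopology X U) (top_of_set {0..<1})) (subtopology X G) c d"
    and A: "closedin X A" "A \<subseteq> U" and U: "U \<subseteq> B"
    and h: "continuous_map (subtopology X B) euclideanreal h" "\<And>x. x \<in> A \<Longrightarrow> h x < 1"
    and BX: "B \<subseteq> topspace X"
  shows "\<exists>T. closedin X T \<and> c ` {(x, t). x \<in> A \<and> 0 \<le> t \<and> t \<le> h x} = T \<inter> G"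
proof -
  let ?P = "prod_topology (subtopology X U) (top_of_set {0..<1::real})"
  let ?R = "{(x, t). x \<in> A \<and> 0 \<le> t \<and> t \<le> h x}"
  have f: "continuous_map ?P (subtopology X U) fst" by (rule continuous_map_fst)
  have fX: "continuous_map ?P X fst" using f continuous_map_in_subtopology by blast
  have s: "continuous_map ?P euclideanreal snd"
    using continuous_map_snd continuous_map_in_subtopology by blast
  have hU: "continuous_map (subtopology X U) euclideanreal h"
    using continuous_map_from_subtopology_mono[OF h(1) U] .
  have hf: "continuous_map ?P euclideanreal (\<lambda>p. h (fst p))"
    using continuous_map_compose[OF f hU] by (simp add: o_def)
  have "closedin ?P ({p \<in> topspace ?P. fst p \<in> A} \<inter> {p \<in> topspace ?P. h (fst p) - snd p \<in> {0..}})"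
  proof (intro closedin_Int)
    show "closedin ?P {p \<in> topspace ?P. fst p \<in> A}" by (rule closedin_continuous_map_preimage[OF fX A(1)])
    have "continuous_map ?P euclideanreal (\<lambda>p. h (fst p) - snd p)"
      using hf s by (intro continuous_intros)
    then show "closedin ?P {p \<in> topspace ?P. h (fst p) - snd p \<in> {0..}}"
      by (rule closedin_continuous_map_preimage) auto
  qed
  moreover have "{p \<in> topspace ?P. fst p \<in> A} \<inter> {p \<in> topspace ?P. h (fst p) - snd p \<in> {0..}} = ?R"
    using A U BX h(2) by fastforce
  ultimately have "closedin ?P ?R" by simp
  moreover have "closed_map ?P (subtopology X G) c"
    by (rule homeomorphic_imp_closed_map[OF homeomorphic_maps_imp_map[OF homeo]])
  ultimately have "closedin (subtopology X G) (c ` ?R)" by (simp add: closed_map_def)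
  then show ?thesis unfolding closedin_subtopology by auto
qed

text \<open>A chart together with an open set \<open>V\<close> so small that its closure meets \<open>B\<close> only inside the base of the
  chart. Regions of the chart that lie in \<open>V\<close> then accumulate outside the chart only at points off \<open>B\<close>.\<close>

definition chart_around :: "'a topology \<Rightarrow> 'a set \<Rightarrow> 'a set \<Rightarrow> 'a set \<Rightarrow> ('a \<times> real \<Rightarrow> 'a) \<Rightarrow>
    ('a \<Rightarrow> 'a \<times> real) \<Rightarrow> bool" where
  "chart_around X B V U c d \<longleftrightarrow> openin X V \<and> openin (subtopology X B) U \<and> U \<subseteq> B \<and>
      openin X (c ` (U \<times> {0..<1})) \<and>
      homeomorphic_maps (prod_topology (subtopology X U) (top_of_set {0..<1}))
        (subtopology X (c ` (U \<times> {0..<1}))) c d \<and>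
      (\<forall>x\<in>U. c (x, 0) = x) \<and> (\<forall>x\<in>U. \<forall>t\<in>{0..<1}. c (x, t) \<in> B \<longrightarrow> t = 0) \<and>
      X closure_of V \<inter> B \<subseteq> U"

lemma chart_around_mono:
  assumes "chart_around X B V U c d" "V' \<subseteq> V" "openin X V'"
  shows "chart_around X B V' U c d"
proof -
  have "X closure_of V' \<inter> B \<subseteq> X closure_of V \<inter> B" using closure_of_mono[OF assms(2)] by blast
  also have "\<dots> \<subseteq> U" using assms(1) by (simp add: chart_around_def)
  finally show ?thesis using assms(1,3) by (simp add: chart_around_def)
qed

text \<open>Around a point \<open>b\<close> the set \<open>V\<close> comes from separating \<open>{b}\<close> from the part of \<open>B\<close> outside the base of a local
  collar. The property passes to smaller open sets, so a locally finite refinement inherits it.\<close>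

lemma locally_finite_charts:
  assumes HB: "Hausdorff_space X" "paracompact_in X B" "closedin X B"
    and loc: "locally_collared_in X B"
  shows "\<exists>\<V>. B \<subseteq> \<Union>\<V> \<and> locally_finite_in X \<V> \<and> (\<forall>V\<in>\<V>. \<exists>U c d. chart_around X B V U c d)"
proof -
  define \<Q> where "\<Q> = {V. \<exists>U c d. chart_around X B V U c d}"
  have BX: "B \<subseteq> topspace X" using HB(3) closedin_subset by blast
  have "\<exists>V\<in>\<Q>. b \<in> V" if b: "b \<in> B" for b
  proof -
    obtain U c where U: "openin (subtopology X B) U" "b \<in> U" "local_collar X B U c"
      using loc b unfolding locally_collared_in_def by blast
    obtain d where d: "homeomorphic_maps (prod_topology (subtopology X U) (top_of_set {0..<1}))
        (subtopology X (c ` (U \<times> {0..<1}))) c d"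
      "openin X (c ` (U \<times> {0..<1}))" "U \<subseteq> B"
      "\<And>x. x \<in> U \<Longrightarrow> c (x, 0) = x"
      "\<And>x t. x \<in> U \<Longrightarrow> t \<in> {0..<1} \<Longrightarrow> c (x, t) \<in> B \<Longrightarrow> t = 0"
      using local_collar_chart[OF HB(3) U(3)] by blast
    have 1: "closedin X {b}" using HB(1) b BX by (simp add: closedin_Hausdorff_singleton in_mono)
    have 2: "closedin X (B - U)"
    proof -
      have "closedin (subtopology X B) (topspace (subtopology X B) - U)" using U(1) by blast
      moreover have "topspace (subtopology X B) - U = B - U" using BX by auto
      ultimately show ?thesis using HB(3) closedin_trans_full by metis
    qed
    obtain P where "openin X P" "{b} \<subseteq> P" "X closure_of P \<inter> (B - U) = {}"
      using paracompact_in_separates_closed[OF HB 1 _ 2] b U(2) by auto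
    then have "chart_around X B P U c d" "b \<in> P" unfolding chart_around_def using U d by auto
    then show ?thesis unfolding \<Q>_def by blast
  qed
  then have "B \<subseteq> \<Union>\<Q>" by blast
  moreover have "\<forall>V\<in>\<Q>. openin X V" unfolding \<Q>_def chart_around_def by blast
  ultimately obtain \<V> where \<V>: "\<forall>V\<in>\<V>. openin X V" "B \<subseteq> \<Union>\<V>" "locally_finite_in X \<V>"
      and ref: "\<forall>V\<in>\<V>. \<exists>Q\<in>\<Q>. V \<subseteq> Q"
    using HB(2)[unfolded paracompact_in_def, rule_format, of \<Q>] by auto
  have "\<exists>U c d. chart_around X B V U c d" if V: "V \<in> \<V>" for V
  proof -
    obtain Q where Q: "Q \<in> \<Q>" "V \<subseteq> Q" using bspec[OF ref V] by (elim bexE)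
    from Q(1) obtain U c d where "chart_around X B Q U c d" unfolding \<Q>_def by auto
    from chart_around_mono[OF this Q(2) bspec[OF \<V>(1) V]] show ?thesis by (intro exI)
  qed
  then show ?thesis using \<V>(2,3) by (intro exI[of _ \<V>] conjI ballI)
qed

text \<open>The slides for all charts, with the partition of unity as translation lengths, are composed. A point
  \<open>(x, s)\<close> of the cylinder moves up along its line, by \<open>\<phi> V x\<close> for each slide, until it enters \<open>S\<close>, where it
  stays. If \<open>s \<le> -1\<close>, it never enters before the last slide and is translated by the total amount \<open>1\<close>. If
  \<open>s \<ge> -1\<close>, it ends up in \<open>S\<close>.\<close>

lemma collared_in_of_charts:
  assumes B: "closedin X B" and S_op: "openin X S" and BS: "B \<subseteq> S"
    and lf\<V>: "locally_finite_in X \<V>"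
    and part: "subordinate_partition X B \<V> \<phi> A"
    and \<kappa>: "continuous_map (subtopology X B) euclideanreal \<kappa>"
    and chart: "\<And>V. V \<in> \<V> \<Longrightarrow> collar_chart X S B (U V) (G V) (A V) (K V) (c V) (d V) \<kappa>"
    and KV: "\<And>V. V \<in> \<V> \<Longrightarrow> K V \<subseteq> V"
  shows "collared_in X B"
proof -
  have BX: "B \<subseteq> topspace X" using B closedin_subset by blast
  have UB: "U V \<subseteq> B" if "V \<in> \<V>" for V using chart[OF that] by (rule collar_chart.U)
  from part have \<phi>_cont: "\<And>V. V \<in> \<V> \<Longrightarrow> continuous_map (subtopology X B) euclideanreal (\<phi> V)"
    and \<phi>_nonneg: "\<And>V x. V \<in> \<V> \<Longrightarrow> x \<in> B \<Longrightarrow> 0 \<le> \<phi> V x"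
    and AV: "\<And>V. V \<in> \<V> \<Longrightarrow> A V \<subseteq> V \<inter> B"
    and \<phi>_zero: "\<And>V x. V \<in> \<V> \<Longrightarrow> x \<in> B - A V \<Longrightarrow> \<phi> V x = 0"
    and \<phi>_sum: "\<And>x. x \<in> B \<Longrightarrow> (\<Sum>V\<in>{V\<in>\<V>. x \<in> V}. \<phi> V x) = 1"
    unfolding subordinate_partition_def by blast+
  let ?Y = "outer_extension X S B"
  have top_Y: "topspace ?Y = S \<times> {0} \<union> B \<times> {..0}"
    using openin_subset[OF S_op] BS by (auto simp: outer_extension_def)
  define pushes where "pushes V k \<longleftrightarrow> homeomorphic_map ?Y ?Y k \<and>
      (\<forall>y\<in>topspace ?Y. fst y \<notin> K V \<longrightarrow> k y = y) \<and>
      (\<forall>x\<in>A V. \<forall>t\<le>- \<phi> V x. k (x, t) = (x, t + \<phi> V x)) \<and>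
      (\<forall>x\<in>A V. \<forall>t. - \<phi> V x \<le> t \<longrightarrow> t \<le> 0 \<longrightarrow> snd (k (x, t)) = 0) \<and>
      (\<forall>x\<in>S. snd (k (x, 0)) = 0)" for V k
  have "\<exists>k. pushes V k" if V: "V \<in> \<V>" for V
  proof -
    interpret collar_chart X S B "U V" "G V" "A V" "K V" "c V" "d V" \<kappa> by (rule chart[OF V])
    show ?thesis unfolding pushes_def
    proof (rule push_exists[of "\<phi> V"])
      show "continuous_map (subtopology X (U V)) euclideanreal (\<phi> V)"
        by (rule continuous_map_from_subtopology_mono[OF \<phi>_cont[OF V] UB[OF V]])
      show "continuous_map (subtopology X (U V)) euclideanreal \<kappa>"
        by (rule continuous_map_from_subtopology_mono[OF \<kappa> UB[OF V]])
    qed (use \<phi>_nonneg[OF V] \<phi>_zero[OF V] UB[OF V] in \<open>blast+\<close>)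
  qed
  then have "\<forall>V\<in>\<V>. \<exists>k. pushes V k" by (intro ballI)
  from bchoice[OF this] obtain k where k: "\<forall>V\<in>\<V>. pushes V (k V)" by (elim exE)
  then have k_homeo: "\<And>V. V \<in> \<V> \<Longrightarrow> homeomorphic_map ?Y ?Y (k V)"
    and k_out: "\<And>V y. V \<in> \<V> \<Longrightarrow> y \<in> topspace ?Y \<Longrightarrow> fst y \<notin> K V \<Longrightarrow> k V y = y"
    and k_low: "\<And>V x t. V \<in> \<V> \<Longrightarrow> x \<in> A V \<Longrightarrow> t \<le> - \<phi> V x \<Longrightarrow> k V (x, t) = (x, t + \<phi> V x)"
    and k_mid: "\<And>V x t. V \<in> \<V> \<Longrightarrow> x \<in> A V \<Longrightarrow> - \<phi> V x \<le> t \<Longrightarrow> t \<le> 0 \<Longrightarrow> snd (k V (x, t)) = 0"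
    and k_zero: "\<And>V x. V \<in> \<V> \<Longrightarrow> x \<in> S \<Longrightarrow> snd (k V (x, 0)) = 0"
    unfolding pushes_def by blast+
  have KA: "x \<in> A V" if "V \<in> \<V>" "x \<in> B" "x \<in> K V" for V x
    using collar_chart.KB[OF chart] that by blast
  have AK: "x \<in> K V" if "V \<in> \<V>" "x \<in> A V" for V x
    using collar_chart.AK[OF chart] that by blast
  let ?K = "\<lambda>V. {y. fst y \<in> K V}"
  have lf: "\<exists>N. openin ?Y N \<and> y \<in> N \<and> finite {V\<in>\<V>. ?K V \<inter> N \<noteq> {}}"
    if y: "y \<in> topspace ?Y" for y
  proof -
    have "fst y \<in> topspace X" using y BX openin_subset[OF S_op] by (auto simp: top_Y)
    then obtain N where N: "openin X N" "fst y \<in> N" "finite {V\<in>\<V>. V \<inter> N \<noteq> {}}"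
      using lf\<V> unfolding locally_finite_in_def by meson
    have "continuous_map ?Y X fst"
      unfolding outer_extension_def by (intro continuous_map_from_subtopology continuous_map_fst)
    then have "openin ?Y {y \<in> topspace ?Y. fst y \<in> N}"
      using N(1) by (rule openin_continuous_map_preimage)
    moreover have "{V\<in>\<V>. ?K V \<inter> {y \<in> topspace ?Y. fst y \<in> N} \<noteq> {}} \<subseteq> {V\<in>\<V>. V \<inter> N \<noteq> {}}"
      using KV by blast
    ultimately show ?thesis using N y finite_subset by blast
  qed
  have "\<exists>E. continuous_map ?Y ?Y E \<and> open_map ?Y ?Y E \<and> inj_on E (topspace ?Y) \<and>
      (\<forall>Q y. descent_invariant ?Y \<V> ?K k Q \<longrightarrow> y \<in> topspace ?Y \<longrightarrow> Q \<V> y \<longrightarrow> Q {} (E y))"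
    by (rule locally_finite_composition) (simp_all add: k_homeo k_out lf)
  then obtain E where E: "continuous_map ?Y ?Y E" "open_map ?Y ?Y E" "inj_on E (topspace ?Y)"
    and inv: "\<forall>Q y. descent_invariant ?Y \<V> ?K k Q \<longrightarrow> y \<in> topspace ?Y \<longrightarrow> Q \<V> y \<longrightarrow> Q {} (E y)"
    by (elim exE conjE)
  \<comment> \<open>The total translation over \<open>x\<close> that the slides with indices in \<open>J\<close>
    still have to perform.\<close>
  define \<sigma> where "\<sigma> J x = (\<Sum>V\<in>{V\<in>J. x \<in> V}. \<phi> V x)" for J x
  have fin: "finite {V\<in>J. x \<in> V}" if J: "J \<subseteq> \<V>" "x \<in> B" for J x
  proof -
    obtain N where "x \<in> N" "finite {V\<in>\<V>. V \<inter> N \<noteq> {}}"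
      using lf\<V> J(2) BX unfolding locally_finite_in_def by (meson in_mono)
    then show ?thesis using J(1) by (elim rev_finite_subset) auto
  qed
  have \<sigma>_skip: "\<sigma> J' x = \<sigma> J x"
    if "J \<subseteq> \<V>" "x \<in> B" "J' \<subseteq> J" "\<And>V. V \<in> J - J' \<Longrightarrow> x \<notin> K V" for J J' x
    unfolding \<sigma>_def
  proof (rule sum.mono_neutral_left)
    show "finite {V\<in>J. x \<in> V}" using fin that by blast
    show "\<forall>V\<in>{V\<in>J. x \<in> V} - {V\<in>J'. x \<in> V}. \<phi> V x = 0"
      using \<phi>_zero AK that by blast
  qed (use that in auto)
  have \<sigma>_act: "\<sigma> (J - {V}) x = \<sigma> J x - \<phi> V x" if J: "J \<subseteq> \<V>" "x \<in> B" "V \<in> J" "x \<in> A V" for J V x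
  proof -
    have "V \<in> {V\<in>J. x \<in> V}" using J AV by blast
    moreover have "{W\<in>J - {V}. x \<in> W} = {W\<in>J. x \<in> W} - {V}" by auto
    ultimately show ?thesis unfolding \<sigma>_def by (simp add: sum_diff1 fin[OF J(1,2)])
  qed
  have \<sigma>_nonneg: "0 \<le> \<sigma> J x" if "J \<subseteq> \<V>" "x \<in> B" for J x
    unfolding \<sigma>_def using \<phi>_nonneg that by (intro sum_nonneg) auto
  have \<sigma>_full: "\<sigma> \<V> x = 1" if "x \<in> B" for x using \<phi>_sum[OF that] by (simp add: \<sigma>_def)
  show ?thesis
  proof (rule collared_in_of_outer_extension[OF S_op BS B E])
    fix x s assume x: "x \<in> B" and s: "s \<le> (-1::real)"
    define Q where "Q J y \<longleftrightarrow> y = (x, s + 1 - \<sigma> J x)" for J y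
    have "Q {} (E (x, s))"
    proof (rule inv[rule_format])
      show "(x, s) \<in> topspace ?Y" using x s by (simp add: top_Y)
      show "Q \<V> (x, s)" using \<sigma>_full[OF x] by (simp add: Q_def)
      show "descent_invariant ?Y \<V> ?K k Q"
        unfolding descent_invariant_def
      proof (intro ballI allI impI conjI)
        fix y J assume J: "J \<subseteq> \<V>" and "Q J y"
        then have y: "y = (x, s + 1 - \<sigma> J x)" by (simp add: Q_def)
        show "Q J' y" if "J' \<subseteq> J" "\<forall>V\<in>J - J'. y \<notin> ?K V" for J'
          using \<sigma>_skip[OF J x that(1)] that(2) y by (auto simp: Q_def)
        show "Q (J - {V}) (k V y)" if V: "V \<in> J" "y \<in> ?K V" for V
        proof -
          have V': "V \<in> \<V>" "x \<in> A V" using V J KA x y by auto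
          have "\<sigma> (J - {V}) x = \<sigma> J x - \<phi> V x" using \<sigma>_act[OF J x V(1) V'(2)] .
          moreover have "0 \<le> \<sigma> (J - {V}) x" using J by (intro \<sigma>_nonneg x) auto
          ultimately show ?thesis
            using k_low[OF V', of "s + 1 - \<sigma> J x"] s y by (auto simp: Q_def)
        qed
      qed
    qed
    then show "E (x, s) = (x, s + 1)" by (simp add: Q_def \<sigma>_def)
  next
    fix x s assume x: "x \<in> B" and s: "(-1::real) \<le> s" "s \<le> 0"
    define Q where "Q J y \<longleftrightarrow> snd y = 0 \<or> fst y = x \<and> snd y \<le> 0 \<and> 0 \<le> snd y + \<sigma> J x"
      for J and y :: "'a \<times> real"
    have "Q {} (E (x, s))"
    proof (rule inv[rule_format])
      show "(x, s) \<in> topspace ?Y" using x s by (simp add: top_Y)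
      show "Q \<V> (x, s)" using \<sigma>_full[OF x] s by (simp add: Q_def)
      show "descent_invariant ?Y \<V> ?K k Q"
        unfolding descent_invariant_def
      proof (intro ballI allI impI conjI)
        fix y J assume y: "y \<in> topspace ?Y" and J: "J \<subseteq> \<V>" and Q: "Q J y"
        show "Q J' y" if "J' \<subseteq> J" "\<forall>V\<in>J - J'. y \<notin> ?K V" for J'
          using Q \<sigma>_skip[OF J x that(1)] that(2) by (auto simp: Q_def)
        show "Q (J - {V}) (k V y)" if V: "V \<in> J" "y \<in> ?K V" for V
        proof -
          have V': "V \<in> \<V>" using J V(1) by (rule subsetD)
          show ?thesis
          proof (cases "snd y = 0")
            case True
            have "fst y \<in> S" using y BS by (auto simp: top_Y)
            then have "snd (k V (fst y, 0)) = 0" by (rule k_zero[OF V'])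
            moreover have "(fst y, 0) = y" using True by (simp add: prod_eq_iff)
            ultimately show ?thesis by (simp add: Q_def)
          next
            case False
            then have *: "fst y = x" "snd y \<le> 0" "0 \<le> snd y + \<sigma> J x" using Q by (auto simp: Q_def)
            obtain t where y_eq: "y = (x, t)" using *(1) by (metis prod.collapse)
            have xA: "x \<in> A V" using KA[OF V' x] V(2) y_eq by simp
            show ?thesis
            proof (cases "t \<le> - \<phi> V x")
              case True
              then show ?thesis
                using k_low[OF V' xA True] * y_eq \<sigma>_act[OF J x V(1) xA] \<phi>_nonneg[OF V' x] by (auto simp: Q_def)
            next
              case False
              then show ?thesis using k_mid[OF V' xA, of t] * y_eq by (auto simp: Q_def)
            qed
          qed
        qed
      qed
    qed
    then show "snd (E (x, s)) = 0" by (auto simp: Q_def \<sigma>_def)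
  qed
qed

theorem theorem4p3:
  fixes X :: "'a topology" and B :: "'a set"
  assumes "Hausdorff_space X"
    and "closedin X B"
    and "locally_collared_in X B"
    and "paracompact_in X B"
  shows "collared_in X B"
proof -
  note HB = assms(1,4,2)
  have BX: "B \<subseteq> topspace X" using assms(2) closedin_subset by blast
  obtain \<V> where \<V>: "B \<subseteq> \<Union>\<V>" "locally_finite_in X \<V>"
      and ex: "\<forall>V\<in>\<V>. \<exists>U c d. chart_around X B V U c d"
    using locally_finite_charts[OF HB assms(3)] by (elim exE conjE)
  from ex obtain U c d where g: "\<And>V. V \<in> \<V> \<Longrightarrow> chart_around X B V (U V) (c V) (d V)" by metis
  define G where "G V = c V ` (U V \<times> {0..<1})" for V
  have V_op: "openin X V" and U_op: "openin (subtopology X B) (U V)" and UB: "U V \<subseteq> B" and G_op: "openin X (G V)"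
    and homeo: "homeomorphic_maps (prod_topology (subtopology X (U V)) (top_of_set {0..<1}))
        (subtopology X (G V)) (c V) (d V)"
    and c0: "\<And>x. x \<in> U V \<Longrightarrow> c V (x, 0) = x"
    and cB: "\<And>x t. x \<in> U V \<Longrightarrow> t \<in> {0..<1} \<Longrightarrow> c V (x, t) \<in> B \<Longrightarrow> t = 0"
    and clU: "X closure_of V \<inter> B \<subseteq> U V" if "V \<in> \<V>" for V
    using g[OF that] unfolding chart_around_def G_def by blast+
  have UG: "U V \<subseteq> G V" if "V \<in> \<V>" for V
    using c0[OF that] by (force simp: G_def intro!: image_eqI[of _ _ "(_, 0)"])
  \<comment> \<open>Remove the limit points of the sets \<open>V\<close> outside their charts. Within
    \<open>S\<close>, closures of subsets of \<open>V\<close> can be computed in the chart.\<close>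
  define S where "S = topspace X - (\<Union>V\<in>\<V>. X closure_of V - G V)"
  have S_op: "openin X S"
  proof -
    have lf: "locally_finite_in X ((\<lambda>V. X closure_of V - G V) ` \<V>)"
      unfolding locally_finite_in_def
    proof (intro conjI ballI)
      show "\<Union> ((\<lambda>V. X closure_of V - G V) ` \<V>) \<subseteq> topspace X"
        using closure_of_subset_topspace by fastforce
      fix x assume "x \<in> topspace X"
      then obtain N where N: "openin X N" "x \<in> N" "finite {V\<in>\<V>. V \<inter> N \<noteq> {}}"
        using \<V>(2) unfolding locally_finite_in_def by meson
      have "{Z \<in> (\<lambda>V. X closure_of V - G V) ` \<V>. Z \<inter> N \<noteq> {}} \<subseteq>
          (\<lambda>V. X closure_of V - G V) ` {V\<in>\<V>. V \<inter> N \<noteq> {}}"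
        using disjoint_open_imp_closure_disjoint[OF N(1)] by blast
      then have "finite {Z \<in> (\<lambda>V. X closure_of V - G V) ` \<V>. Z \<inter> N \<noteq> {}}"
        using N(3) finite_surj by blast
      then show "\<exists>N. openin X N \<and> x \<in> N \<and>
          finite {Z \<in> (\<lambda>V. X closure_of V - G V) ` \<V>. Z \<inter> N \<noteq> {}}" using N by blast
    qed
    have "closedin X (\<Union>V\<in>\<V>. X closure_of V - G V)"
      by (rule closedin_locally_finite_Union[OF _ lf]) (use G_op in \<open>auto intro: closedin_diff\<close>)
    then show ?thesis unfolding S_def by blast
  qed
  have BS: "B \<subseteq> S"
    unfolding S_def using BX clU UG by blast
  have clS: "x \<in> G V" if "V \<in> \<V>" "x \<in> X closure_of V" "x \<in> S" for x V
    using that by (auto simp: S_def)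
  have V_cl: "V \<subseteq> X closure_of V" if "V \<in> \<V>" for V
    using V_op that by (simp add: closure_of_subset openin_subset)
  obtain \<phi> A where part: "subordinate_partition X B \<V> \<phi> A"
    using paracompact_in_partition_of_unity[OF HB V_op \<V>] by blast
  then have A_closed: "\<And>V. V \<in> \<V> \<Longrightarrow> closedin X (A V)" and AV: "\<And>V. V \<in> \<V> \<Longrightarrow> A V \<subseteq> V \<inter> B"
    unfolding subordinate_partition_def by blast+
  have AU: "A V \<subseteq> U V" if "V \<in> \<V>" for V
    using AV[OF that] clU[OF that] V_cl[OF that] by blast
  \<comment> \<open>Heights below which every chart whose bump function may be nonzero at \<open>x\<close> stays
    in \<open>V\<close>, for local finiteness, and in \<open>S\<close>.\<close>
  define low where "low x s \<longleftrightarrow> s < 1 \<and>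
      (\<forall>V\<in>\<V>. x \<in> A V \<longrightarrow> (\<forall>t. 0 \<le> t \<longrightarrow> t \<le> s \<longrightarrow> c V (x, t) \<in> V \<inter> S))" for x and s :: real
  have low_loc: "\<exists>N \<epsilon>. openin X N \<and> b \<in> N \<and> \<epsilon> > 0 \<and> (\<forall>x\<in>N \<inter> B. low x \<epsilon>)" if b: "b \<in> B" for b
  proof -
    obtain N0 where N0: "openin X N0" "b \<in> N0" "finite {V\<in>\<V>. V \<inter> N0 \<noteq> {}}"
      using \<V>(2) b BX unfolding locally_finite_in_def by (meson in_mono)
    let ?F = "{V\<in>\<V>. V \<inter> N0 \<noteq> {}}"
    define fits where "fits V N \<epsilon> \<longleftrightarrow> openin X N \<and> b \<in> N \<and> 0 < \<epsilon> \<and> \<epsilon> < 1 \<and>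
        (\<forall>x t. x \<in> N \<inter> B \<inter> A V \<longrightarrow> 0 \<le> t \<longrightarrow> t \<le> \<epsilon> \<longrightarrow> c V (x, t) \<in> V \<inter> S)" for V N \<epsilon>
    have fits_ex: "\<exists>N \<epsilon>. fits V N \<epsilon>" if V: "V \<in> \<V>" for V
    proof (cases "b \<in> A V")
      case True
      have cc: "continuous_map (prod_topology (subtopology X (U V)) (top_of_set {0..<1})) X (c V)"
        using homeo[OF V] by (simp add: homeomorphic_maps_def continuous_map_in_subtopology)
      have "openin X (V \<inter> S)" using V V_op S_op by blast
      moreover have "b \<in> U V" using AU V True by blast
      moreover have "c V (b, 0) \<in> V \<inter> S"
      proof -
        have "b \<in> U V" "b \<in> V \<inter> S" using AU[OF V] AV[OF V] True BS by auto
        then show ?thesis using c0[OF V] by simp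
      qed
      ultimately obtain N \<epsilon> where "openin X N" "b \<in> N" "0 < \<epsilon>" "\<epsilon> < 1"
          "\<forall>x t. x \<in> N \<inter> B \<longrightarrow> 0 \<le> t \<longrightarrow> t \<le> \<epsilon> \<longrightarrow> c V (x, t) \<in> V \<inter> S"
        using chart_height[OF cc U_op[OF V]] by meson
      then have "fits V N \<epsilon>" by (simp add: fits_def)
      then show ?thesis by (intro exI)
    next
      case False
      then have "fits V (topspace X - A V) (1/2)" using A_closed[OF V] b BX by (auto simp: fits_def)
      then show ?thesis by (intro exI)
    qed
    obtain N \<epsilon> where "\<And>V. V \<in> \<V> \<Longrightarrow> fits V (N V) (\<epsilon> V)" using fits_ex by metis
    then have N: "\<And>V. V \<in> \<V> \<Longrightarrow> openin X (N V)" "\<And>V. V \<in> \<V> \<Longrightarrow> b \<in> N V"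
        "\<And>V. V \<in> \<V> \<Longrightarrow> 0 < \<epsilon> V" "\<And>V. V \<in> \<V> \<Longrightarrow> \<epsilon> V < (1::real)"
        "\<And>V x t. V \<in> \<V> \<Longrightarrow> x \<in> N V \<inter> B \<inter> A V \<Longrightarrow> 0 \<le> t \<Longrightarrow> t \<le> \<epsilon> V \<Longrightarrow> c V (x, t) \<in> V \<inter> S"
      unfolding fits_def by blast+
    let ?N = "N0 \<inter> topspace X \<inter> \<Inter>(N ` ?F)" and ?e = "Min (insert (1/2) (\<epsilon> ` ?F))"
    have "openin X ?N"
    proof (cases "?F = {}")
      case True
      show ?thesis unfolding True using N0(1) by (simp add: openin_Int)
    next
      case False
      then have "openin X (\<Inter>(N ` ?F))" using N0(3) N(1) by (intro openin_Inter) auto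
      then show ?thesis using N0 by blast
    qed
    moreover have "b \<in> ?N" using N0 N b BX by auto
    moreover have "0 < ?e" using N0(3) N(3) by auto
    moreover have "low x ?e" if x: "x \<in> ?N \<inter> B" for x
      unfolding low_def
    proof (intro conjI ballI impI allI)
      show "?e < 1" using N0(3) by (intro le_less_trans[of ?e "1/2" 1] Min_le) auto
      fix V t assume V: "V \<in> \<V>" "x \<in> A V" "0 \<le> t" "t \<le> ?e"
      then have VF: "V \<in> ?F" using AV x by blast
      then have "?e \<le> \<epsilon> V" using N0(3) by (intro Min_le) auto
      then show "c V (x, t) \<in> V \<inter> S" using N(5)[OF V(1) _ V(3)] V x VF by auto
    qed
    ultimately show ?thesis by blast
  qed
  have "\<exists>\<kappa>. continuous_map (subtopology X B) euclideanreal \<kappa> \<and> (\<forall>x\<in>B. 0 < \<kappa> x \<and> low x (\<kappa> x))"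
  proof (rule paracompact_in_continuous_selection[OF HB])
    show "low x s" if "low x t" "s \<le> t" for x s t
      using that unfolding low_def by (meson le_less_trans order_trans)
  qed (rule low_loc)
  then obtain \<kappa> where \<kappa>: "continuous_map (subtopology X B) euclideanreal \<kappa>"
    "\<And>x. x \<in> B \<Longrightarrow> 0 < \<kappa> x" "\<And>x. x \<in> B \<Longrightarrow> low x (\<kappa> x)"
    by auto
  define K where "K V = c V ` {(x, t). x \<in> A V \<and> 0 \<le> t \<and> t \<le> \<kappa> x}" for V
  have KV: "K V \<subseteq> V \<inter> S" if "V \<in> \<V>" for V
    using \<kappa>(3) AV[OF that] that unfolding K_def low_def by blast
  have K_closed: "closedin (subtopology X S) (K V)" if V: "V \<in> \<V>" for V
  proof -
    have "\<kappa> x < 1" if "x \<in> A V" for x using \<kappa>(3) AV[OF V] that by (auto simp: low_def)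
    then have "\<exists>T. closedin X T \<and> K V = T \<inter> G V"
      unfolding K_def
      by (rule closedin_chart_region[OF homeo[OF V] A_closed[OF V] AU[OF V] UB[OF V] \<kappa>(1) _ BX])
    then obtain T where T: "closedin X T" "K V = T \<inter> G V" by (elim exE conjE)
    \<comment> \<open>Every point of \<open>S\<close> in the closure of \<open>V\<close> lies in the chart, where
      \<open>K V\<close> is closed.\<close>
    have "K V = (T \<inter> X closure_of V) \<inter> S"
      using T(2) KV[OF V] V_cl[OF V] clS[OF V] by blast
    moreover have "closedin X (T \<inter> X closure_of V)" using T(1) by (intro closedin_Int closedin_closure_of)
    ultimately show ?thesis unfolding closedin_subtopology by (intro exI conjI)
  qed
  have chart: "collar_chart X S B (U V) (G V) (A V) (K V) (c V) (d V) \<kappa>" if V: "V \<in> \<V>" for V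
  proof (rule collar_chart.intro)
    show "openin X S" "B \<subseteq> S" "U V \<subseteq> B" "openin X (G V)" "A V \<subseteq> U V"
      using S_op BS UB[OF V] G_op[OF V] AU[OF V] .
    show "homeomorphic_maps (prod_topology (subtopology X (U V)) (top_of_set {0..<1}))
        (subtopology X (G V)) (c V) (d V)" using homeo[OF V] .
    show "c V (x, 0) = x" if "x \<in> U V" for x using c0[OF V that] .
    show "t = 0" if "x \<in> U V" "t \<in> {0..<1}" "c V (x, t) \<in> B" for x t using cB[OF V that] .
    show "0 < \<kappa> x" "\<kappa> x < 1" if "x \<in> U V" for x
      using \<kappa>(2,3)[of x] UB[OF V] that by (auto simp: low_def)
    show "K V = c V ` {(x, t). x \<in> A V \<and> 0 \<le> t \<and> t \<le> \<kappa> x}" by (simp add: K_def)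
    show "closedin (subtopology X S) (K V)" using K_closed[OF V] .
  qed
  show ?thesis
    by (rule collared_in_of_charts[OF assms(2) S_op BS \<V>(2) part \<kappa>(1) chart]) (use KV in blast)+
qed

end
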